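(* Let $L$ be the Fra\"iss\'e limit of the class of all finite nontrivial Heyting algebras, and let $B=\{a\in L\mid \neg\neg a=a\}$ be the Boolean algebra of regular elements of $L$. Let $h_{\neg\neg}:\mathrm{Aut}(L)\to\mathrm{Aut}(B)$ be the continuous homomorphism given by restriction, $h_{\neg\neg}(f)=f\upharpoonright B$. Then $h_{\neg\neg}$ is injective and is a homeomorphism onto its image. However, $h_{\neg\neg}$ is not surjective, and its image is a non-dense, non-open subset of $\mathrm{Aut}(B)$.
   Context: Heyting algebras are structures in the language $\{0,1,\wedge,\vee,\to\}$; nontrivial means $0\neq 1$; $\neg a$ denotes $a\to 0$. The Fra\"iss\'e limit $L$ is the (unique up to isomorphism) countable Heyting algebra that is ultrahomogeneous (every isomorphism between finitely generated substructures of $L$ extends to an automorphism of $L$) and whose finitely generated substructures are, up to isomorphism, exactly the finite nontrivial Heyting algebras. It is known to exist. The set $B$ of regular elements of $L$ (those with $\neg\neg a=a$) is a Boolean algebra under the order induced from $L$: its meet, complement, $0$ and $1$ are the restrictions of $\wedge$, $\neg$, $0$, $1$ of $L$, and its join is $a\vee^B b=\neg\neg(a\vee b)$. It is countable and atomless. Since $B$ and its operations are $0$-definable in $L$, every automorphism of $L$ restricts to an automorphism of $B$. Automorphism groups of countable structures carry the topology of pointwise convergence, in which the pointwise stabilizers of finite sets form a neighbourhood basis of the identity. *)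

theory Defs
  imports "HOL-Analysis.Analysis" "HOL-Algebra.Bij"
begin

section \<open>Heyting algebras as first-order structures\<close>

record 'a bounded_lat = "'a partial_object" +
  lbot :: 'a
  ltop :: 'a
  lmeet :: "'a \<Rightarrow> 'a \<Rightarrow> 'a"
  ljoin :: "'a \<Rightarrow> 'a \<Rightarrow> 'a"

record 'a heyting = "'a bounded_lat" +
  limp :: "'a \<Rightarrow> 'a \<Rightarrow> 'a"

record 'a boolean = "'a bounded_lat" +
  lcompl :: "'a \<Rightarrow> 'a"

definition lat_le :: "('a, 'm) bounded_lat_scheme \<Rightarrow> 'a \<Rightarrow> 'a \<Rightarrow> bool"
  where "lat_le L a b \<longleftrightarrow> lmeet L a b = a"

definition hneg :: "'a heyting \<Rightarrow> 'a \<Rightarrow> 'a"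
  where "hneg L a = limp L a (lbot L)"

text \<open>A Heyting algebra is a bounded lattice (given by the usual identities) in which
  \<open>limp\<close> is the residual of \<open>lmeet\<close>. The case \<open>lbot = ltop\<close> is allowed.\<close>

locale heyting_algebra =
  fixes L :: "'a heyting"
  assumes bot_closed: "lbot L \<in> carrier L"
    and top_closed: "ltop L \<in> carrier L"
    and meet_closed: "\<lbrakk>a \<in> carrier L; b \<in> carrier L\<rbrakk> \<Longrightarrow> lmeet L a b \<in> carrier L"
    and join_closed: "\<lbrakk>a \<in> carrier L; b \<in> carrier L\<rbrakk> \<Longrightarrow> ljoin L a b \<in> carrier L"
    and imp_closed: "\<lbrakk>a \<in> carrier L; b \<in> carrier L\<rbrakk> \<Longrightarrow> limp L a b \<in> carrier L"
    and meet_comm: "\<lbrakk>a \<in> carrier L; b \<in> carrier L\<rbrakk> \<Longrightarrow> lmeet L a b = lmeet L b a"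
    and join_comm: "\<lbrakk>a \<in> carrier L; b \<in> carrier L\<rbrakk> \<Longrightarrow> ljoin L a b = ljoin L b a"
    and meet_assoc: "\<lbrakk>a \<in> carrier L; b \<in> carrier L; c \<in> carrier L\<rbrakk>
      \<Longrightarrow> lmeet L (lmeet L a b) c = lmeet L a (lmeet L b c)"
    and join_assoc: "\<lbrakk>a \<in> carrier L; b \<in> carrier L; c \<in> carrier L\<rbrakk>
      \<Longrightarrow> ljoin L (ljoin L a b) c = ljoin L a (ljoin L b c)"
    and meet_join_absorb: "\<lbrakk>a \<in> carrier L; b \<in> carrier L\<rbrakk> \<Longrightarrow> lmeet L a (ljoin L a b) = a"
    and join_meet_absorb: "\<lbrakk>a \<in> carrier L; b \<in> carrier L\<rbrakk> \<Longrightarrow> ljoin L a (lmeet L a b) = a"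
    and bot_least: "a \<in> carrier L \<Longrightarrow> lat_le L (lbot L) a"
    and top_greatest: "a \<in> carrier L \<Longrightarrow> lat_le L a (ltop L)"
    and imp_residual: "\<lbrakk>a \<in> carrier L; b \<in> carrier L; c \<in> carrier L\<rbrakk>
      \<Longrightarrow> lat_le L (lmeet L c a) b \<longleftrightarrow> lat_le L c (limp L a b)"

definition finite_nontrivial_heyting :: "'a heyting \<Rightarrow> bool"
  where "finite_nontrivial_heyting L \<longleftrightarrow>
    heyting_algebra L \<and> finite (carrier L) \<and> lbot L \<noteq> ltop L"


section \<open>Isomorphisms and substructures\<close>

definition bounded_lat_iso ::
    "('a, 'm) bounded_lat_scheme \<Rightarrow> ('b, 'n) bounded_lat_scheme \<Rightarrow> ('a \<Rightarrow> 'b) set"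
  where "bounded_lat_iso K L = {f. bij_betw f (carrier K) (carrier L) \<and>
    f (lbot K) = lbot L \<and> f (ltop K) = ltop L \<and>
    (\<forall>a\<in>carrier K. \<forall>b\<in>carrier K. f (lmeet K a b) = lmeet L (f a) (f b)) \<and>
    (\<forall>a\<in>carrier K. \<forall>b\<in>carrier K. f (ljoin K a b) = ljoin L (f a) (f b))}"

definition heyting_iso :: "'a heyting \<Rightarrow> 'b heyting \<Rightarrow> ('a \<Rightarrow> 'b) set"
  where "heyting_iso K L = {f \<in> bounded_lat_iso K L.
    \<forall>a\<in>carrier K. \<forall>b\<in>carrier K. f (limp K a b) = limp L (f a) (f b)}"

definition boolean_iso :: "'a boolean \<Rightarrow> 'b boolean \<Rightarrow> ('a \<Rightarrow> 'b) set"
  where "boolean_iso K L = {f \<in> bounded_lat_iso K L.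
    \<forall>a\<in>carrier K. f (lcompl K a) = lcompl L (f a)}"

definition heyting_closed :: "'a heyting \<Rightarrow> 'a set \<Rightarrow> bool"
  where "heyting_closed L S \<longleftrightarrow> S \<subseteq> carrier L \<and> lbot L \<in> S \<and> ltop L \<in> S \<and>
    (\<forall>a\<in>S. \<forall>b\<in>S. lmeet L a b \<in> S \<and> ljoin L a b \<in> S \<and> limp L a b \<in> S)"

definition fg_substructure :: "'a heyting \<Rightarrow> 'a heyting \<Rightarrow> bool"
  where "fg_substructure A L \<longleftrightarrow>
    (\<exists>X. finite X \<and> X \<subseteq> carrier L \<and> A = L\<lparr>carrier := heyting_closed L hull X\<rparr>)"


section \<open>Automorphism groups and the topology of pointwise convergence\<close>

definition heyting_aut :: "'a heyting \<Rightarrow> ('a \<Rightarrow> 'a) set"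
  where "heyting_aut L = heyting_iso L L \<inter> Bij (carrier L)"

definition boolean_aut :: "'a boolean \<Rightarrow> ('a \<Rightarrow> 'a) set"
  where "boolean_aut B = boolean_iso B B \<inter> Bij (carrier B)"

definition heyting_AutoGroup :: "'a heyting \<Rightarrow> ('a \<Rightarrow> 'a) monoid"
  where "heyting_AutoGroup L = BijGroup (carrier L)\<lparr>carrier := heyting_aut L\<rparr>"

definition boolean_AutoGroup :: "'a boolean \<Rightarrow> ('a \<Rightarrow> 'a) monoid"
  where "boolean_AutoGroup B = BijGroup (carrier B)\<lparr>carrier := boolean_aut B\<rparr>"

definition pointwise_topology :: "'a set \<Rightarrow> ('a \<Rightarrow> 'a) set \<Rightarrow> ('a \<Rightarrow> 'a) topology"
  where "pointwise_topology S G =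
    subtopology (product_topology (\<lambda>_. discrete_topology S) S) G"

abbreviation heyting_aut_topology :: "'a heyting \<Rightarrow> ('a \<Rightarrow> 'a) topology"
  where "heyting_aut_topology L \<equiv> pointwise_topology (carrier L) (heyting_aut L)"

abbreviation boolean_aut_topology :: "'a boolean \<Rightarrow> ('a \<Rightarrow> 'a) topology"
  where "boolean_aut_topology B \<equiv> pointwise_topology (carrier B) (boolean_aut B)"

lemma topspace_pointwise_topology:
  assumes "G \<subseteq> Bij S"
  shows "topspace (pointwise_topology S G) = G"
proof -
  have "G \<subseteq> S \<rightarrow>\<^sub>E S"
    using assms by (auto simp: Bij_def PiE_def bij_betw_def)
  then show ?thesis
    by (auto simp: pointwise_topology_def)
qed

lemma topspace_heyting_aut_topology [simp]: "topspace (heyting_aut_topology L) = heyting_aut L"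
  by (rule topspace_pointwise_topology) (simp add: heyting_aut_def)

lemma topspace_boolean_aut_topology [simp]: "topspace (boolean_aut_topology B) = boolean_aut B"
  by (rule topspace_pointwise_topology) (simp add: boolean_aut_def)


section \<open>The Fraisse limit\<close>

text \<open>The members of the class of finite nontrivial Heyting algebras are taken with carriers in
  \<open>nat\<close>, since one cannot quantify over types; every finite Heyting algebra has an isomorphic copy
  of this kind, see \<open>heyting_fraisse_limit_universal\<close>. Conversely, as the class is closed under
  isomorphism, a finitely generated substructure is isomorphic to a member iff it is itself finite
  and nontrivial.\<close>

definition heyting_fraisse_limit :: "'a heyting \<Rightarrow> bool"
  where "heyting_fraisse_limit L \<longleftrightarrow>
    heyting_algebra L \<and> countable (carrier L) \<and>
    (\<forall>A A' g. fg_substructure A L \<and> fg_substructure A' L \<and> g \<in> heyting_iso A A' \<longrightarrow>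
      (\<exists>f\<in>heyting_aut L. \<forall>x\<in>carrier A. f x = g x)) \<and>
    (\<forall>A. fg_substructure A L \<longrightarrow> finite_nontrivial_heyting A) \<and>
    (\<forall>H::nat heyting. finite_nontrivial_heyting H \<longrightarrow>
      (\<exists>A. fg_substructure A L \<and> heyting_iso H A \<noteq> {}))"

lemma heyting_iso_trans:
  assumes "f \<in> heyting_iso K L" and "g \<in> heyting_iso L M"
  shows "g \<circ> f \<in> heyting_iso K M"
proof -
  have "f a \<in> carrier L" if "a \<in> carrier K" for a
    using assms(1) that by (auto simp: heyting_iso_def bounded_lat_iso_def bij_betw_def)
  then show ?thesis
    using assms by (auto simp: heyting_iso_def bounded_lat_iso_def intro: bij_betw_trans)
qed

lemma finite_nontrivial_heyting_nat_copy:
  fixes H :: "'b heyting"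
  assumes "finite_nontrivial_heyting H"
  shows "\<exists>H'::nat heyting. finite_nontrivial_heyting H' \<and> heyting_iso H H' \<noteq> {}"
proof -
  interpret heyting_algebra H
    using assms by (simp add: finite_nontrivial_heyting_def)
  have fin: "finite (carrier H)" and nt: "lbot H \<noteq> ltop H"
    using assms by (simp_all add: finite_nontrivial_heyting_def)
  obtain f :: "'b \<Rightarrow> nat" where inj: "inj_on f (carrier H)"
    using finite_imp_inj_to_nat_seg[OF fin] by blast
  define g where "g = inv_into (carrier H) f"
  have gf [simp]: "g (f a) = a" if "a \<in> carrier H" for a
    using inj that by (simp add: g_def)
  have eq [simp]: "f a = f b \<longleftrightarrow> a = b" if "a \<in> carrier H" "b \<in> carrier H" for a b
    using inj that by (auto simp: inj_on_def)
  define H' where "H' = \<lparr>carrier = f ` carrier H, lbot = f (lbot H), ltop = f (ltop H),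
    lmeet = (\<lambda>x y. f (lmeet H (g x) (g y))), ljoin = (\<lambda>x y. f (ljoin H (g x) (g y))),
    limp = (\<lambda>x y. f (limp H (g x) (g y)))\<rparr>"
  note clo [simp] = bot_closed top_closed meet_closed join_closed imp_closed
  have le: "lat_le H' (f a) (f b) \<longleftrightarrow> lat_le H a b" if "a \<in> carrier H" "b \<in> carrier H" for a b
    using that by (simp add: lat_le_def H'_def)
  have m: "lmeet H' (f a) (f b) = f (lmeet H a b)" "ljoin H' (f a) (f b) = f (ljoin H a b)"
    "limp H' (f a) (f b) = f (limp H a b)" if "a \<in> carrier H" "b \<in> carrier H" for a b
    using that by (simp_all add: H'_def)
  have c: "carrier H' = f ` carrier H" "lbot H' = f (lbot H)" "ltop H' = f (ltop H)"
    by (simp_all add: H'_def)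
  have "heyting_algebra H'"
    by unfold_locales
      (auto simp: c m le meet_assoc join_assoc meet_join_absorb join_meet_absorb
         bot_least top_greatest imp_residual intro: meet_comm join_comm)
  then have "finite_nontrivial_heyting H'"
    using fin nt by (simp add: finite_nontrivial_heyting_def c)
  moreover have "f \<in> heyting_iso H H'"
    using inj by (simp add: heyting_iso_def bounded_lat_iso_def bij_betw_def c m)
  ultimately show ?thesis by blast
qed

lemma heyting_fraisse_limit_universal:
  fixes H :: "'b heyting"
  assumes "heyting_fraisse_limit L" and "finite_nontrivial_heyting H"
  shows "\<exists>A. fg_substructure A L \<and> heyting_iso H A \<noteq> {}"
proof -
  obtain H' :: "nat heyting" and f
    where "finite_nontrivial_heyting H'" "f \<in> heyting_iso H H'"
    using finite_nontrivial_heyting_nat_copy[OF assms(2)] by blast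
  then obtain A g where "fg_substructure A L" "g \<in> heyting_iso H' A"
    using assms(1) unfolding heyting_fraisse_limit_def by blast
  then show ?thesis
    using heyting_iso_trans[OF \<open>f \<in> heyting_iso H H'\<close>] by blast
qed


section \<open>Regular elements\<close>

definition regular_algebra :: "'a heyting \<Rightarrow> 'a boolean"
  where "regular_algebra L =
    \<lparr>carrier = {a \<in> carrier L. hneg L (hneg L a) = a},
     lbot = lbot L, ltop = ltop L, lmeet = lmeet L,
     ljoin = (\<lambda>a b. hneg L (hneg L (ljoin L a b))),
     lcompl = hneg L\<rparr>"

definition h_negneg :: "'a heyting \<Rightarrow> ('a \<Rightarrow> 'a) \<Rightarrow> ('a \<Rightarrow> 'a)"
  where "h_negneg L f = restrict f (carrier (regular_algebra L))"

end

(* Every automorphism of L is determined by its values on regular elements because each a in L lies in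
   the subalgebra generated by finitely many regular ones. Indeed, a finite subalgebra A containing a
   is an algebra of up-sets of a finite poset P; this poset is a p-morphic image of a finite tree in
   which every non-leaf has several children, and there every principal up-set is regular. By
   homogeneity the resulting extension of A is realised inside L.

   For the negative part, take a finite set F of regular elements, let Up(P) be the subalgebra it
   generates, and extend it to Up(P x R), where R consists of two disjoint copies of a root with two
   leaves. Exchanging the copies gives an automorphism f of L fixing F. Let d consist of the first leaf
   of each copy. Acting as f below d and as the identity below its complement is an automorphism of B
   which fixes F, but it sends one of the copies, a complemented element of L, to an element that is
   not complemented in L. So it cannot be the restriction of an automorphism of L. *)

theory Submission
  imports Defs "HOL-Library.Sublist"
begin

section \<open>Heyting algebras\<close>

context heyting_algebra
begin

abbreviation le :: "'a \<Rightarrow> 'a \<Rightarrow> bool" (infix "\<preceq>" 50) where "a \<preceq> b \<equiv> lat_le L a b"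
abbreviation meet :: "'a \<Rightarrow> 'a \<Rightarrow> 'a" (infixl "\<^bold>\<and>" 70) where "a \<^bold>\<and> b \<equiv> lmeet L a b"
abbreviation join :: "'a \<Rightarrow> 'a \<Rightarrow> 'a" (infixl "\<^bold>\<or>" 65) where "a \<^bold>\<or> b \<equiv> ljoin L a b"
abbreviation neg :: "'a \<Rightarrow> 'a" ("\<^bold>\<not> _" [81] 80) where "\<^bold>\<not> a \<equiv> hneg L a"

lemmas closed = bot_closed top_closed meet_closed join_closed imp_closed

lemma neg_closed: "a \<in> carrier L \<Longrightarrow> \<^bold>\<not> a \<in> carrier L"
  by (simp add: hneg_def closed)

declare closed [simp] neg_closed [simp]

lemma meet_idem: "a \<in> carrier L \<Longrightarrow> a \<^bold>\<and> a = a"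
  by (metis join_closed join_meet_absorb meet_join_absorb)

lemma le_refl [simp]: "a \<in> carrier L \<Longrightarrow> a \<preceq> a"
  by (simp add: lat_le_def meet_idem)

lemma le_antisym: "\<lbrakk>a \<preceq> b; b \<preceq> a; a \<in> carrier L; b \<in> carrier L\<rbrakk> \<Longrightarrow> a = b"
  by (metis lat_le_def meet_comm)

lemma le_trans: "\<lbrakk>a \<preceq> b; b \<preceq> c; a \<in> carrier L; b \<in> carrier L; c \<in> carrier L\<rbrakk> \<Longrightarrow> a \<preceq> c"
  by (metis lat_le_def meet_assoc)

lemma meet_le1 [simp]: "\<lbrakk>a \<in> carrier L; b \<in> carrier L\<rbrakk> \<Longrightarrow> a \<^bold>\<and> b \<preceq> a"
  by (metis lat_le_def meet_assoc meet_comm meet_closed meet_idem)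

lemma meet_le2 [simp]: "\<lbrakk>a \<in> carrier L; b \<in> carrier L\<rbrakk> \<Longrightarrow> a \<^bold>\<and> b \<preceq> b"
  by (metis meet_comm meet_le1)

lemma le_meet_iff:
  "\<lbrakk>a \<in> carrier L; b \<in> carrier L; c \<in> carrier L\<rbrakk> \<Longrightarrow> c \<preceq> a \<^bold>\<and> b \<longleftrightarrow> c \<preceq> a \<and> c \<preceq> b"
  by (metis lat_le_def le_trans meet_assoc meet_closed meet_le1 meet_le2)

lemma le_iff_join: "\<lbrakk>a \<in> carrier L; b \<in> carrier L\<rbrakk> \<Longrightarrow> a \<preceq> b \<longleftrightarrow> a \<^bold>\<or> b = b"
  by (metis join_comm join_meet_absorb lat_le_def meet_comm meet_join_absorb)

lemma join_ge1 [simp]: "\<lbrakk>a \<in> carrier L; b \<in> carrier L\<rbrakk> \<Longrightarrow> a \<preceq> a \<^bold>\<or> b"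
  by (simp add: lat_le_def meet_join_absorb)

lemma join_ge2 [simp]: "\<lbrakk>a \<in> carrier L; b \<in> carrier L\<rbrakk> \<Longrightarrow> b \<preceq> a \<^bold>\<or> b"
  by (metis join_comm join_ge1)

lemma join_le_iff:
  "\<lbrakk>a \<in> carrier L; b \<in> carrier L; c \<in> carrier L\<rbrakk> \<Longrightarrow> a \<^bold>\<or> b \<preceq> c \<longleftrightarrow> a \<preceq> c \<and> b \<preceq> c"
  by (metis join_assoc join_closed join_ge1 join_ge2 le_iff_join le_trans)

text \<open>Residuation yields distributivity: \<open>a\<close> and \<open>b\<close> both lie below
  the implication from \<open>c\<close> to the right-hand side, hence so does their join.\<close>

lemma meet_join_distrib:
  assumes [simp]: "a \<in> carrier L" "b \<in> carrier L" "c \<in> carrier L"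
  shows "(a \<^bold>\<or> b) \<^bold>\<and> c = (a \<^bold>\<and> c) \<^bold>\<or> (b \<^bold>\<and> c)"
proof (rule le_antisym)
  have "a \<^bold>\<or> b \<preceq> limp L c ((a \<^bold>\<and> c) \<^bold>\<or> (b \<^bold>\<and> c))"
    by (subst join_le_iff) (simp_all add: imp_residual [symmetric])
  then show "(a \<^bold>\<or> b) \<^bold>\<and> c \<preceq> (a \<^bold>\<and> c) \<^bold>\<or> (b \<^bold>\<and> c)"
    using imp_residual [of c "(a \<^bold>\<and> c) \<^bold>\<or> (b \<^bold>\<and> c)" "a \<^bold>\<or> b"] by simp
  have "a \<^bold>\<and> c \<preceq> a \<^bold>\<or> b" "b \<^bold>\<and> c \<preceq> a \<^bold>\<or> b"
    by (rule le_trans [OF meet_le1], simp_all)+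
  then show "(a \<^bold>\<and> c) \<^bold>\<or> (b \<^bold>\<and> c) \<preceq> (a \<^bold>\<or> b) \<^bold>\<and> c"
    by (simp add: join_le_iff le_meet_iff)
qed simp_all

lemma le_bot_iff: "a \<in> carrier L \<Longrightarrow> a \<preceq> lbot L \<longleftrightarrow> a = lbot L"
  by (metis bot_closed bot_least le_antisym)

section \<open>Pseudocomplements and double negation\<close>

lemma le_neg_iff:
  "\<lbrakk>a \<in> carrier L; c \<in> carrier L\<rbrakk> \<Longrightarrow> c \<preceq> \<^bold>\<not> a \<longleftrightarrow> c \<^bold>\<and> a = lbot L"
  by (simp add: hneg_def imp_residual [symmetric] le_bot_iff)

lemma meet_neg [simp]: "a \<in> carrier L \<Longrightarrow> a \<^bold>\<and> \<^bold>\<not> a = lbot L"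
  by (metis le_neg_iff le_refl meet_comm neg_closed)

lemma le_neg_commute: "\<lbrakk>a \<in> carrier L; c \<in> carrier L\<rbrakk> \<Longrightarrow> c \<preceq> \<^bold>\<not> a \<longleftrightarrow> a \<preceq> \<^bold>\<not> c"
  by (metis le_neg_iff meet_comm)

lemma le_negneg: "a \<in> carrier L \<Longrightarrow> a \<preceq> \<^bold>\<not> (\<^bold>\<not> a)"
  by (simp add: le_neg_iff)

lemma neg_antimono: "\<lbrakk>a \<preceq> b; a \<in> carrier L; b \<in> carrier L\<rbrakk> \<Longrightarrow> \<^bold>\<not> b \<preceq> \<^bold>\<not> a"
  by (meson le_neg_commute le_negneg le_trans neg_closed)

lemma negnegneg [simp]: "a \<in> carrier L \<Longrightarrow> \<^bold>\<not> (\<^bold>\<not> (\<^bold>\<not> a)) = \<^bold>\<not> a"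
  by (meson le_antisym le_negneg neg_antimono neg_closed)

lemma neg_join:
  assumes [simp]: "a \<in> carrier L" "b \<in> carrier L"
  shows "\<^bold>\<not> (a \<^bold>\<or> b) = \<^bold>\<not> a \<^bold>\<and> \<^bold>\<not> b"
proof (rule le_antisym)
  show "\<^bold>\<not> (a \<^bold>\<or> b) \<preceq> \<^bold>\<not> a \<^bold>\<and> \<^bold>\<not> b"
    by (simp add: le_meet_iff neg_antimono)
  have "a \<preceq> \<^bold>\<not> (\<^bold>\<not> a \<^bold>\<and> \<^bold>\<not> b)" "b \<preceq> \<^bold>\<not> (\<^bold>\<not> a \<^bold>\<and> \<^bold>\<not> b)"
    by (simp_all add: le_neg_commute [of "\<^bold>\<not> a \<^bold>\<and> \<^bold>\<not> b"])
  then show "\<^bold>\<not> a \<^bold>\<and> \<^bold>\<not> b \<preceq> \<^bold>\<not> (a \<^bold>\<or> b)"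
    by (simp add: le_neg_commute [of "a \<^bold>\<or> b"] join_le_iff)
qed simp_all

lemma neg_bot: "\<^bold>\<not> (lbot L) = ltop L"
  by (rule le_antisym) (simp_all add: top_greatest le_neg_commute [of "lbot L"] bot_least)

lemma neg_top: "\<^bold>\<not> (ltop L) = lbot L"
  by (metis lat_le_def meet_comm meet_neg neg_closed top_closed top_greatest)

text \<open>Negation is local: inside \<open>b\<close> it sees only the part of \<open>a\<close>
  below \<open>b\<close>. This is what later allows negations to be computed separately below
  \<open>d\<close> and below its negation.\<close>

lemma meet_neg_meet:
  assumes [simp]: "a \<in> carrier L" "b \<in> carrier L"
  shows "\<^bold>\<not> (a \<^bold>\<and> b) \<^bold>\<and> b = \<^bold>\<not> a \<^bold>\<and> b"
proof (rule le_antisym)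
  have "\<^bold>\<not> (a \<^bold>\<and> b) \<^bold>\<and> b \<^bold>\<and> a = \<^bold>\<not> (a \<^bold>\<and> b) \<^bold>\<and> (a \<^bold>\<and> b)"
    by (simp add: meet_assoc meet_comm [of b])
  also have "\<dots> = lbot L"
    by (simp add: meet_comm [of "\<^bold>\<not> (a \<^bold>\<and> b)"])
  finally show "\<^bold>\<not> (a \<^bold>\<and> b) \<^bold>\<and> b \<preceq> \<^bold>\<not> a \<^bold>\<and> b"
    by (simp add: le_meet_iff le_neg_iff)
  have "\<^bold>\<not> a \<preceq> \<^bold>\<not> (a \<^bold>\<and> b)"
    by (simp add: neg_antimono)
  then have "\<^bold>\<not> a \<^bold>\<and> b \<preceq> \<^bold>\<not> (a \<^bold>\<and> b)"
    by (rule le_trans [rotated]) simp_all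
  then show "\<^bold>\<not> a \<^bold>\<and> b \<preceq> \<^bold>\<not> (a \<^bold>\<and> b) \<^bold>\<and> b"
    by (simp add: le_meet_iff)
qed simp_all

text \<open>Disjointness from an element is the same as disjointness from its double negation.
  Applying this to \<open>a\<close> and then to \<open>b\<close> turns the disjointness of
  \<open>a\<close>, \<open>b\<close> and the negation of their meet into the nontrivial
  inequality.\<close>

lemma negneg_meet:
  assumes [simp]: "a \<in> carrier L" "b \<in> carrier L"
  shows "\<^bold>\<not> (\<^bold>\<not> (a \<^bold>\<and> b)) = \<^bold>\<not> (\<^bold>\<not> a) \<^bold>\<and> \<^bold>\<not> (\<^bold>\<not> b)"
proof (rule le_antisym)
  show "\<^bold>\<not> (\<^bold>\<not> (a \<^bold>\<and> b)) \<preceq> \<^bold>\<not> (\<^bold>\<not> a) \<^bold>\<and> \<^bold>\<not> (\<^bold>\<not> b)"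
    by (simp add: le_meet_iff neg_antimono)
  have "\<^bold>\<not> (a \<^bold>\<and> b) \<^bold>\<and> b \<preceq> \<^bold>\<not> a"
    by (simp add: meet_neg_meet)
  then have "\<^bold>\<not> (\<^bold>\<not> a) \<^bold>\<and> (\<^bold>\<not> (a \<^bold>\<and> b) \<^bold>\<and> b) = lbot L"
    by (simp add: le_neg_iff [symmetric] neg_antimono)
  \<comment> \<open>The triple negation equals a single one; writing it this way makes
    \<open>le_neg_iff\<close> hand back the double negation of \<open>b\<close> in the next
    step.\<close>
  then have "\<^bold>\<not> (\<^bold>\<not> a) \<^bold>\<and> \<^bold>\<not> (a \<^bold>\<and> b) \<preceq> \<^bold>\<not> (\<^bold>\<not> (\<^bold>\<not> b))"
    by (simp add: le_neg_iff meet_assoc)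
  then have "\<^bold>\<not> (\<^bold>\<not> a) \<^bold>\<and> \<^bold>\<not> (a \<^bold>\<and> b) \<^bold>\<and> \<^bold>\<not> (\<^bold>\<not> b) = lbot L"
    by (subst (asm) le_neg_iff) simp_all
  then show "\<^bold>\<not> (\<^bold>\<not> a) \<^bold>\<and> \<^bold>\<not> (\<^bold>\<not> b) \<preceq> \<^bold>\<not> (\<^bold>\<not> (a \<^bold>\<and> b))"
    by (simp add: le_neg_iff meet_assoc meet_comm [of "\<^bold>\<not> (\<^bold>\<not> b)"])
qed simp_all

text \<open>Intersecting the double negation with the top element, written as the join of
  \<open>a\<close> and its negation, leaves only a part of \<open>a\<close>.\<close>

lemma complemented_imp_regular:
  assumes "a \<^bold>\<or> \<^bold>\<not> a = ltop L" and [simp]: "a \<in> carrier L"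
  shows "\<^bold>\<not> (\<^bold>\<not> a) = a"
proof (rule le_antisym)
  have "\<^bold>\<not> (\<^bold>\<not> a) = (a \<^bold>\<or> \<^bold>\<not> a) \<^bold>\<and> \<^bold>\<not> (\<^bold>\<not> a)"
    unfolding assms(1) by (metis assms(2) lat_le_def meet_comm neg_closed top_closed top_greatest)
  also have "\<dots> = a \<^bold>\<and> \<^bold>\<not> (\<^bold>\<not> a) \<^bold>\<or> lbot L"
    using assms(2) by (simp add: meet_join_distrib)
  also have "\<dots> = a \<^bold>\<and> \<^bold>\<not> (\<^bold>\<not> a)"
    by (metis assms(2) bot_closed bot_least join_comm le_iff_join meet_closed neg_closed)
  finally have *: "\<^bold>\<not> (\<^bold>\<not> a) = a \<^bold>\<and> \<^bold>\<not> (\<^bold>\<not> a)" .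
  show "\<^bold>\<not> (\<^bold>\<not> a) \<preceq> a"
    by (subst *) simp
qed (simp_all add: le_negneg)

text \<open>The join of \<open>d\<close> and its negation is dense, though possibly not top. The
  parts below \<open>d\<close> and below its negation therefore recover an element up to double
  negation, which is enough for regular ones.\<close>

lemma regular_meet_cong:
  assumes "a \<^bold>\<and> d = b \<^bold>\<and> d" "a \<^bold>\<and> \<^bold>\<not> d = b \<^bold>\<and> \<^bold>\<not> d" "\<^bold>\<not> (\<^bold>\<not> a) = a" "\<^bold>\<not> (\<^bold>\<not> b) = b"
    and [simp]: "a \<in> carrier L" "b \<in> carrier L" "d \<in> carrier L"
  shows "a = b"
proof -
  have top: "\<^bold>\<not> (\<^bold>\<not> (d \<^bold>\<or> \<^bold>\<not> d)) = ltop L"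
    by (simp add: neg_join neg_bot)
  have "a' = \<^bold>\<not> (\<^bold>\<not> ((d \<^bold>\<and> a') \<^bold>\<or> (\<^bold>\<not> d \<^bold>\<and> a')))" if "\<^bold>\<not> (\<^bold>\<not> a') = a'" and [simp]: "a' \<in> carrier L" for a'
  proof -
    have "\<^bold>\<not> (\<^bold>\<not> ((d \<^bold>\<and> a') \<^bold>\<or> (\<^bold>\<not> d \<^bold>\<and> a'))) = ltop L \<^bold>\<and> a'"
      using that by (simp add: meet_join_distrib [symmetric] negneg_meet top)
    moreover have "ltop L \<^bold>\<and> a' = a'"
      by (metis lat_le_def meet_comm that(2) top_closed top_greatest)
    ultimately show ?thesis by simp
  qed
  note split = this
  have eqs: "d \<^bold>\<and> a = d \<^bold>\<and> b" "\<^bold>\<not> d \<^bold>\<and> a = \<^bold>\<not> d \<^bold>\<and> b"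
    using assms(1,2) by (simp_all add: meet_comm [of _ a] meet_comm [of _ b])
  have "a = \<^bold>\<not> (\<^bold>\<not> ((d \<^bold>\<and> a) \<^bold>\<or> (\<^bold>\<not> d \<^bold>\<and> a)))"
    using assms by (intro split)
  also have "\<dots> = b"
    unfolding eqs using assms by (intro split [symmetric])
  finally show ?thesis .
qed

end

section \<open>Embeddings\<close>

context heyting_algebra
begin

lemma heyting_closed_carrier: "heyting_closed L (carrier L)"
  by (simp add: heyting_closed_def)

lemma heyting_closed_hull:
  assumes "X \<subseteq> carrier L"
  shows "heyting_closed L (heyting_closed L hull X)"
proof -
  have "heyting_closed L hull X \<subseteq> carrier L"
    using assms by (rule hull_minimal) (rule heyting_closed_carrier)
  then show ?thesis
    by (auto simp: heyting_closed_def hull_def)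
qed

end

text \<open>Values outside the carrier are left arbitrary, so embeddings compose with plain function
  composition. Isomorphisms are the surjective embeddings, by
  \<open>heyting_iso_iff\<close>.\<close>

definition heyting_emb :: "'a heyting \<Rightarrow> 'b heyting \<Rightarrow> ('a \<Rightarrow> 'b) set"
  where "heyting_emb K L = {f \<in> carrier K \<rightarrow> carrier L. inj_on f (carrier K) \<and>
    f (lbot K) = lbot L \<and> f (ltop K) = ltop L \<and>
    (\<forall>a\<in>carrier K. \<forall>b\<in>carrier K. f (lmeet K a b) = lmeet L (f a) (f b) \<and>
       f (ljoin K a b) = ljoin L (f a) (f b) \<and> f (limp K a b) = limp L (f a) (f b))}"

lemma heyting_embD:
  assumes "f \<in> heyting_emb K L"
  shows "inj_on f (carrier K)" "f (lbot K) = lbot L" "f (ltop K) = ltop L"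
    and "a \<in> carrier K \<Longrightarrow> f a \<in> carrier L"
    and "\<lbrakk>a \<in> carrier K; b \<in> carrier K\<rbrakk> \<Longrightarrow> f (lmeet K a b) = lmeet L (f a) (f b)"
    and "\<lbrakk>a \<in> carrier K; b \<in> carrier K\<rbrakk> \<Longrightarrow> f (ljoin K a b) = ljoin L (f a) (f b)"
    and "\<lbrakk>a \<in> carrier K; b \<in> carrier K\<rbrakk> \<Longrightarrow> f (limp K a b) = limp L (f a) (f b)"
  using assms by (auto simp: heyting_emb_def)

lemma heyting_emb_hneg:
  assumes "f \<in> heyting_emb K L" "heyting_algebra K" "a \<in> carrier K"
  shows "f (hneg K a) = hneg L (f a)"
  using assms by (simp add: hneg_def heyting_embD heyting_algebra.bot_closed)

lemma heyting_iso_iff: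
  "f \<in> heyting_iso K L \<longleftrightarrow> f \<in> heyting_emb K L \<and> f ` carrier K = carrier L"
  by (auto simp: heyting_iso_def bounded_lat_iso_def heyting_emb_def bij_betw_def)

lemma heyting_emb_comp:
  "\<lbrakk>f \<in> heyting_emb K L; g \<in> heyting_emb L M\<rbrakk> \<Longrightarrow> g \<circ> f \<in> heyting_emb K M"
  by (auto simp: heyting_emb_def Pi_iff inj_on_def)

lemma heyting_aut_emb: "f \<in> heyting_aut L \<Longrightarrow> f \<in> heyting_emb L L"
  by (simp add: heyting_aut_def heyting_iso_iff)

lemma heyting_emb_substructure:
  assumes "f \<in> heyting_emb K (L\<lparr>carrier := S\<rparr>)" "S \<subseteq> carrier L"
  shows "f \<in> heyting_emb K L"
  using assms by (auto simp: heyting_emb_def)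

lemma heyting_emb_inclusion:
  assumes "heyting_closed L S"
  shows "(\<lambda>x. x) \<in> heyting_emb (L\<lparr>carrier := S\<rparr>) L"
  using assms by (auto simp: heyting_emb_def heyting_closed_def)

lemma heyting_closed_emb_image:
  assumes "heyting_algebra K" "f \<in> heyting_emb K L"
  shows "heyting_closed L (f ` carrier K)"
proof -
  interpret K: heyting_algebra K by fact
  note f = heyting_embD [OF assms(2)]
  have "f a \<in> f ` carrier K" if "a \<in> carrier K" for a
    using that by simp
  moreover have "lbot L \<in> f ` carrier K" "ltop L \<in> f ` carrier K"
    using K.bot_closed K.top_closed f(2,3) by (metis image_eqI)+
  ultimately show ?thesis
    by (auto simp: heyting_closed_def f(4) simp flip: f(5-7))
qed

text \<open>The image is closed under the operations and finite, so it serves as its own generating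
  set.\<close>

lemma fg_substructure_emb_image:
  assumes "heyting_algebra K" "finite (carrier K)" "f \<in> heyting_emb K L"
  shows "fg_substructure (L\<lparr>carrier := f ` carrier K\<rparr>) L"
proof -
  have "heyting_closed L (f ` carrier K)"
    using assms heyting_closed_emb_image by blast
  moreover from this have "f ` carrier K \<subseteq> carrier L"
    by (simp add: heyting_closed_def)
  ultimately show ?thesis
    using assms(2) unfolding fg_substructure_def
    by (intro exI [of _ "f ` carrier K"]) (simp add: hull_same)
qed

lemma fg_substructureE:
  assumes "heyting_algebra L" "fg_substructure A L"
  obtains S where "A = L\<lparr>carrier := S\<rparr>" "heyting_closed L S"
  using assms heyting_algebra.heyting_closed_hull unfolding fg_substructure_def by blast

section \<open>Homogeneity and extension in the Fraisse limit\<close>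

text \<open>Ultrahomogeneity restated for embeddings: \<open>g\<close> after the inverse of
  \<open>f\<close> is an isomorphism between two finitely generated substructures, the
  images.\<close>

lemma fraisse_emb_conjugate:
  assumes L: "heyting_fraisse_limit L"
    and K: "heyting_algebra K" "finite (carrier K)"
    and f: "f \<in> heyting_emb K L" and g: "g \<in> heyting_emb K L"
  shows "\<exists>h\<in>heyting_aut L. \<forall>a\<in>carrier K. h (f a) = g a"
proof -
  interpret K: heyting_algebra K by fact
  let ?A = "L\<lparr>carrier := f ` carrier K\<rparr>" and ?B = "L\<lparr>carrier := g ` carrier K\<rparr>"
  define k where "k = g \<circ> inv_into (carrier K) f"
  note fD = heyting_embD [OF f] and gD = heyting_embD [OF g]
  have k [simp]: "k (f a) = g a" if "a \<in> carrier K" for a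
    using that fD(1) by (simp add: k_def)
  have "k \<in> heyting_emb ?A ?B"
    unfolding heyting_emb_def
  proof (safe)
    show "inj_on k (carrier ?A)"
      using gD(1) by (auto simp: inj_on_def)
    show "k (lbot ?A) = lbot ?B"
      using k [OF K.bot_closed] fD(2) gD(2) by simp
    show "k (ltop ?A) = ltop ?B"
      using k [OF K.top_closed] fD(3) gD(3) by simp
  qed (auto simp: gD(5-7) simp flip: fD(5-7))
  moreover have "k ` carrier ?A = carrier ?B"
    by (auto simp: image_image)
  ultimately have "k \<in> heyting_iso ?A ?B"
    by (simp add: heyting_iso_iff)
  moreover have "fg_substructure ?A L" "fg_substructure ?B L"
    using fg_substructure_emb_image K f g by blast+
  ultimately obtain h where "h \<in> heyting_aut L" "\<forall>x\<in>carrier ?A. h x = k x"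
    using L unfolding heyting_fraisse_limit_def by blast
  then show ?thesis
    by auto
qed

text \<open>Universality places some copy of \<open>H\<close> in \<open>L\<close>, but possibly over
  the wrong copy of \<open>K\<close>; homogeneity moves it so that it extends
  \<open>i\<close>.\<close>

lemma fraisse_emb_extension:
  assumes L: "heyting_fraisse_limit L"
    and K: "heyting_algebra K" "finite (carrier K)" and H: "finite_nontrivial_heyting H"
    and i: "i \<in> heyting_emb K L" and j: "j \<in> heyting_emb K H"
  shows "\<exists>e\<in>heyting_emb H L. \<forall>a\<in>carrier K. e (j a) = i a"
proof -
  have "heyting_algebra L"
    using L by (simp add: heyting_fraisse_limit_def)
  obtain A g where A: "fg_substructure A L" and g: "g \<in> heyting_iso H A"
    using heyting_fraisse_limit_universal [OF L H] by blast
  obtain S where "A = L\<lparr>carrier := S\<rparr>" "heyting_closed L S"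
    using fg_substructureE [OF \<open>heyting_algebra L\<close> A] .
  then have g': "g \<in> heyting_emb H L"
    using g heyting_emb_substructure by (auto simp: heyting_iso_iff heyting_closed_def)
  obtain h where h: "h \<in> heyting_aut L" "\<forall>a\<in>carrier K. h ((g \<circ> j) a) = i a"
    using fraisse_emb_conjugate [OF L K heyting_emb_comp [OF j g'] i] by blast
  have "h \<circ> g \<in> heyting_emb H L"
    using heyting_emb_comp [OF g' heyting_aut_emb [OF h(1)]] .
  then show ?thesis
    using h(2) by (intro bexI [of _ "h \<circ> g"]) auto
qed

section \<open>Algebras of up-sets\<close>

text \<open>The algebra of propositions of an intuitionistic Kripke frame; \<open>limp\<close> is
  the forcing clause for implication.\<close>

definition upset_algebra :: "'w set \<Rightarrow> ('w \<Rightarrow> 'w \<Rightarrow> bool) \<Rightarrow> 'w set heyting"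
  where "upset_algebra W r = \<lparr>carrier = {U. U \<subseteq> W \<and> (\<forall>s\<in>U. \<forall>t\<in>W. r s t \<longrightarrow> t \<in> U)},
    lbot = {}, ltop = W, lmeet = (\<inter>), ljoin = (\<union>),
    limp = (\<lambda>U V. {s\<in>W. \<forall>t\<in>W. r s t \<longrightarrow> t \<in> U \<longrightarrow> t \<in> V})\<rparr>"

lemma upset_algebra_simps [simp]:
  "carrier (upset_algebra W r) = {U. U \<subseteq> W \<and> (\<forall>s\<in>U. \<forall>t\<in>W. r s t \<longrightarrow> t \<in> U)}"
  "lbot (upset_algebra W r) = {}" "ltop (upset_algebra W r) = W"
  "lmeet (upset_algebra W r) = (\<inter>)" "ljoin (upset_algebra W r) = (\<union>)"
  "limp (upset_algebra W r) U V = {s\<in>W. \<forall>t\<in>W. r s t \<longrightarrow> t \<in> U \<longrightarrow> t \<in> V}"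
  "hneg (upset_algebra W r) U = {s\<in>W. \<forall>t\<in>W. r s t \<longrightarrow> t \<notin> U}"
  by (simp_all add: upset_algebra_def hneg_def)

text \<open>Transitivity makes implications up-sets; reflexivity gives the half of residuation that
  evaluates an implication at the world itself.\<close>

lemma heyting_algebra_upset_algebra:
  assumes r: "reflp_on W r" "transp_on W r"
  shows "heyting_algebra (upset_algebra W r)"
proof
  fix U V X
  assume UVX: "U \<in> carrier (upset_algebra W r)" "V \<in> carrier (upset_algebra W r)"
    "X \<in> carrier (upset_algebra W r)"
  have "X \<inter> U \<subseteq> V \<longleftrightarrow> X \<subseteq> {s\<in>W. \<forall>t\<in>W. r s t \<longrightarrow> t \<in> U \<longrightarrow> t \<in> V}" (is "_ \<longleftrightarrow> X \<subseteq> ?I")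
  proof
    assume "X \<inter> U \<subseteq> V"
    moreover have "X \<subseteq> W" "\<forall>s\<in>X. \<forall>t\<in>W. r s t \<longrightarrow> t \<in> X"
      using UVX(3) by auto
    ultimately show "X \<subseteq> ?I" by blast
  next
    assume *: "X \<subseteq> ?I"
    show "X \<inter> U \<subseteq> V"
    proof
      fix s assume s: "s \<in> X \<inter> U"
      then have "s \<in> ?I" using * by blast
      then show "s \<in> V" using s reflp_onD [OF r(1)] by simp
    qed
  qed
  then show "lat_le (upset_algebra W r) (lmeet (upset_algebra W r) X U) V \<longleftrightarrow>
      lat_le (upset_algebra W r) X (limp (upset_algebra W r) U V)"
    by (simp only: lat_le_def upset_algebra_simps le_iff_inf)
next
  fix U V
  assume "U \<in> carrier (upset_algebra W r)" "V \<in> carrier (upset_algebra W r)"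
  show "limp (upset_algebra W r) U V \<in> carrier (upset_algebra W r)"
    unfolding upset_algebra_simps using transp_onD [OF r(2)] by blast
qed (auto simp: lat_le_def)

lemma finite_nontrivial_upset_algebra:
  assumes "reflp_on W r" "transp_on W r" "finite W" "W \<noteq> {}"
  shows "finite_nontrivial_heyting (upset_algebra W r)"
  using assms heyting_algebra_upset_algebra [OF assms(1,2)]
  by (auto simp: finite_nontrivial_heyting_def intro: finite_subset [of _ "Pow W"])

section \<open>Join primes as the points of the dual frame of a finite Heyting algebra\<close>

definition join_primes :: "'a heyting \<Rightarrow> 'a set"
  where "join_primes L = {p \<in> carrier L. p \<noteq> lbot L \<and>
    (\<forall>a\<in>carrier L. \<forall>b\<in>carrier L. lat_le L p (ljoin L a b) \<longrightarrow> lat_le L p a \<or> lat_le L p b)}"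

text \<open>Take \<open>q\<close> minimal among the elements below \<open>c\<close> and not below
  \<open>b\<close>; everything strictly below \<open>q\<close> is then below \<open>b\<close>. If
  \<open>q\<close> were below a join but below neither joinand, distributivity would write it as a
  join of two strictly smaller elements, putting it below \<open>b\<close>.\<close>

lemma (in heyting_algebra) join_prime_separation:
  assumes fin: "finite (carrier L)" and c: "c \<in> carrier L" and b: "b \<in> carrier L"
    and "\<not> c \<preceq> b"
  obtains q where "q \<in> join_primes L" "q \<preceq> c" "\<not> q \<preceq> b"
proof -
  let ?X = "{x \<in> carrier L. x \<preceq> c \<and> \<not> x \<preceq> b}"
  let ?less = "\<lambda>x y. x \<preceq> y \<and> x \<noteq> y"
  have "asymp_on ?X ?less"
    by (rule asymp_onI) (auto dest: le_antisym)
  moreover have "transp_on ?X ?less"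
    by (rule transp_onI) (auto dest: le_antisym intro: le_trans)
  moreover have "finite ?X" "?X \<noteq> {}"
    using assms by (auto intro: exI [of _ c])
  ultimately obtain q where q: "q \<in> ?X" and min: "\<forall>x\<in>?X. x \<noteq> q \<longrightarrow> \<not> (?less x q)"
    using Finite_Set.bex_min_element [of ?X ?less] by auto
  then have [simp]: "q \<in> carrier L" by simp
  have below: "x \<preceq> b" if "x \<in> carrier L" "x \<preceq> q" "x \<noteq> q" for x
    using that min q c le_trans [of x q c] by auto
  have "q \<in> join_primes L"
    unfolding join_primes_def
  proof safe
    show False if "q = lbot L"
      using that q b bot_least by auto
  next
    fix x y assume [simp]: "x \<in> carrier L" "y \<in> carrier L"
      and "q \<preceq> x \<^bold>\<or> y" and y: "\<not> q \<preceq> y"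
    then have eq: "q = (x \<^bold>\<and> q) \<^bold>\<or> (y \<^bold>\<and> q)"
      by (metis \<open>q \<in> carrier L\<close> join_closed lat_le_def meet_comm meet_join_distrib)
    have "y \<^bold>\<and> q \<noteq> q"
      using y by (metis \<open>q \<in> carrier L\<close> \<open>y \<in> carrier L\<close> meet_le1)
    then have "y \<^bold>\<and> q \<preceq> b"
      by (intro below) simp_all
    show "q \<preceq> x"
    proof (rule ccontr)
      assume x: "\<not> q \<preceq> x"
      have "x \<^bold>\<and> q \<noteq> q"
        using x by (metis \<open>q \<in> carrier L\<close> \<open>x \<in> carrier L\<close> meet_le1)
      then have "x \<^bold>\<and> q \<preceq> b"
        by (intro below) simp_all
      with \<open>y \<^bold>\<and> q \<preceq> b\<close> have "(x \<^bold>\<and> q) \<^bold>\<or> (y \<^bold>\<and> q) \<preceq> b"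
        using b by (simp add: join_le_iff)
      with q eq show False by simp
    qed
  qed simp_all
  then show thesis
    using q that by blast
qed

text \<open>A finite Kripke frame over the dual poset of \<open>L\<close>: since passing to larger up-sets of worlds
  means passing to smaller join primes, \<open>\<pi>\<close> reverses the order. The last assumption is the back
  condition of a p-morphism.\<close>

locale covering_frame = heyting_algebra L for L :: "'a heyting" +
  fixes W :: "'w set" and r :: "'w \<Rightarrow> 'w \<Rightarrow> bool" and \<pi> :: "'w \<Rightarrow> 'a"
  assumes nontrivial: "finite_nontrivial_heyting L"
    and finite_worlds: "finite W"
    and refl: "reflp_on W r" and trans: "transp_on W r"
    and surj: "\<pi> ` W = join_primes L"
    and antimono: "\<lbrakk>s \<in> W; t \<in> W; r s t\<rbrakk> \<Longrightarrow> \<pi> t \<preceq> \<pi> s"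
    and lift: "\<lbrakk>s \<in> W; q \<in> join_primes L; q \<preceq> \<pi> s\<rbrakk> \<Longrightarrow> \<exists>t\<in>W. r s t \<and> \<pi> t = q"
begin

lemma finite_carrier: "finite (carrier L)"
  using nontrivial by (simp add: finite_nontrivial_heyting_def)

lemma finite_nontrivial_frame: "finite_nontrivial_heyting (upset_algebra W r)"
proof (rule finite_nontrivial_upset_algebra [OF refl trans finite_worlds])
  have "\<not> ltop L \<preceq> lbot L"
    using nontrivial by (auto simp: le_bot_iff finite_nontrivial_heyting_def)
  then show "W \<noteq> {}"
    using join_prime_separation [OF finite_carrier top_closed bot_closed] surj by blast
qed

text \<open>This map is dual to \<open>\<pi>\<close>. Separation by join primes gives injectivity,
  primality preserves joins, and the lifting condition supplies the harder half of preserving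
  implication.\<close>

lemma frame_emb: "(\<lambda>a. {s \<in> W. \<pi> s \<preceq> a}) \<in> heyting_emb L (upset_algebra W r)"
proof -
  have prime: "\<pi> s \<in> join_primes L" if "s \<in> W" for s
    using that surj by blast
  then have car [simp]: "\<pi> s \<in> carrier L" if "s \<in> W" for s
    using that by (auto simp: join_primes_def)
  have sub: "a \<preceq> b" if ab: "a \<in> carrier L" "b \<in> carrier L" "{s \<in> W. \<pi> s \<preceq> a} \<subseteq> {s \<in> W. \<pi> s \<preceq> b}"
    for a b
  proof (rule ccontr)
    assume "\<not> a \<preceq> b"
    then obtain q where "q \<in> join_primes L" "q \<preceq> a" "\<not> q \<preceq> b"
      using join_prime_separation [OF finite_carrier] ab by blast
    moreover then obtain s where "s \<in> W" "q = \<pi> s"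
      using surj by blast
    ultimately show False
      using ab(3) by blast
  qed
  have imp: "\<pi> s \<preceq> limp L a b \<longleftrightarrow> (\<forall>t\<in>W. r s t \<longrightarrow> \<pi> t \<preceq> a \<longrightarrow> \<pi> t \<preceq> b)"
    if s: "s \<in> W" and [simp]: "a \<in> carrier L" "b \<in> carrier L" for s a b
  proof -
    have "\<pi> s \<preceq> limp L a b \<longleftrightarrow> \<pi> s \<^bold>\<and> a \<preceq> b"
      using s by (simp add: imp_residual)
    also have "\<dots> \<longleftrightarrow> (\<forall>t\<in>W. r s t \<longrightarrow> \<pi> t \<preceq> a \<longrightarrow> \<pi> t \<preceq> b)"
    proof safe
      fix t assume t: "\<pi> s \<^bold>\<and> a \<preceq> b" "t \<in> W" "r s t" "\<pi> t \<preceq> a"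
      then have "\<pi> t \<preceq> \<pi> s \<^bold>\<and> a"
        using s antimono by (simp add: le_meet_iff)
      then show "\<pi> t \<preceq> b"
        using t s by (meson car le_trans meet_closed that(2,3))
    next
      assume *: "\<forall>t\<in>W. r s t \<longrightarrow> \<pi> t \<preceq> a \<longrightarrow> \<pi> t \<preceq> b"
      show "\<pi> s \<^bold>\<and> a \<preceq> b"
      proof (rule ccontr)
        assume "\<not> \<pi> s \<^bold>\<and> a \<preceq> b"
        \<comment> \<open>A failing inequality is witnessed by a join prime, which
          \<open>lift\<close> realises at a world above \<open>s\<close>.\<close>
        then obtain q where q: "q \<in> join_primes L" "q \<preceq> \<pi> s \<^bold>\<and> a" "\<not> q \<preceq> b"
          using join_prime_separation [OF finite_carrier, of "\<pi> s \<^bold>\<and> a" b] s by auto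
        then have "q \<preceq> \<pi> s" "q \<preceq> a"
          using s by (auto simp: le_meet_iff join_primes_def)
        then show False
          using lift [OF s q(1)] * q(3) by blast
      qed
    qed
    finally show ?thesis .
  qed
  have join: "\<pi> s \<preceq> a \<^bold>\<or> b \<longleftrightarrow> \<pi> s \<preceq> a \<or> \<pi> s \<preceq> b"
    if "s \<in> W" "a \<in> carrier L" "b \<in> carrier L" for s a b
  proof
    show "\<pi> s \<preceq> a \<or> \<pi> s \<preceq> b" if "\<pi> s \<preceq> a \<^bold>\<or> b"
      using prime [OF \<open>s \<in> W\<close>] that \<open>a \<in> carrier L\<close> \<open>b \<in> carrier L\<close> unfolding join_primes_def by blast
    show "\<pi> s \<preceq> a \<^bold>\<or> b" if "\<pi> s \<preceq> a \<or> \<pi> s \<preceq> b"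
      using that \<open>s \<in> W\<close> \<open>a \<in> carrier L\<close> \<open>b \<in> carrier L\<close> le_trans [of "\<pi> s" _ "a \<^bold>\<or> b"] by auto
  qed
  have up: "\<pi> t \<preceq> a" if "s \<in> W" "t \<in> W" "r s t" "\<pi> s \<preceq> a" "a \<in> carrier L" for s t a
    using that antimono [of s t] le_trans [of "\<pi> t" "\<pi> s" a] by auto
  let ?\<phi> = "\<lambda>a. {s \<in> W. \<pi> s \<preceq> a}"
  have "?\<phi> a \<in> carrier (upset_algebra W r)" if "a \<in> carrier L" for a
    using up that by (simp only: upset_algebra_simps) blast
  moreover have "inj_on ?\<phi> (carrier L)"
    by (intro inj_onI le_antisym sub) simp_all
  moreover have "?\<phi> (lbot L) = {}"
    using prime by (auto simp: le_bot_iff join_primes_def)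
  moreover have "?\<phi> (ltop L) = W"
    by (auto simp: top_greatest)
  moreover have "?\<phi> (a \<^bold>\<and> b) = ?\<phi> a \<inter> ?\<phi> b" if "a \<in> carrier L" "b \<in> carrier L" for a b
    using that by (auto simp: le_meet_iff)
  moreover have "?\<phi> (a \<^bold>\<or> b) = ?\<phi> a \<union> ?\<phi> b" if "a \<in> carrier L" "b \<in> carrier L" for a b
    using that by (auto simp: join)
  moreover have "?\<phi> (limp L a b) = {s \<in> W. \<forall>t\<in>W. r s t \<longrightarrow> t \<in> ?\<phi> a \<longrightarrow> t \<in> ?\<phi> b}"
    if "a \<in> carrier L" "b \<in> carrier L" for a b
    using that by (auto simp: imp)
  ultimately show ?thesis
    unfolding heyting_emb_def by simp
qed

end

text \<open>Dual form of the extension property: a frame covering the dual poset of \<open>A\<close>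
  gives a larger finite algebra, and a copy of it can be found in \<open>L\<close> over
  \<open>A\<close> itself, with every element of \<open>A\<close> kept in place.\<close>

lemma fraisse_frame_extension:
  assumes L: "heyting_fraisse_limit L" and A: "fg_substructure A L"
    and "covering_frame A W r \<pi>"
  obtains e where "e \<in> heyting_emb (upset_algebra W r) L"
    "\<And>a. a \<in> carrier A \<Longrightarrow> e {s \<in> W. lat_le A (\<pi> s) a} = a"
proof -
  interpret covering_frame A W r \<pi> by fact
  obtain S where S: "A = L\<lparr>carrier := S\<rparr>" "heyting_closed L S"
    using fg_substructureE [OF _ A] L unfolding heyting_fraisse_limit_def by metis
  have "(\<lambda>x. x) \<in> heyting_emb A L"
    using heyting_emb_inclusion [OF S(2)] S(1) by simp
  from fraisse_emb_extension [OF L heyting_algebra_axioms finite_carrier finite_nontrivial_frame this frame_emb]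
  show thesis
    using that by blast
qed

section \<open>Generation by regular elements\<close>

text \<open>Unravelling the dual poset into a tree, with every child duplicated by a boolean tag, separates
  incomparable nodes so well that every principal up-set is regular.\<close>

definition tree_frame :: "'a heyting \<Rightarrow> ('a \<times> bool) list set"
  where "tree_frame L = {s. s \<noteq> [] \<and> fst ` set s \<subseteq> join_primes L \<and>
    sorted_wrt (\<lambda>x y. lat_le L (fst y) (fst x) \<and> fst y \<noteq> fst x) s}"

text \<open>A world is a strictly descending tagged chain of join primes, projected to its last
  entry. Strict descent makes the entries distinct, so there are finitely many worlds; a prime
  strictly below the last entry is reached by appending it.\<close>

lemma (in heyting_algebra) covering_frame_tree:
  assumes fin: "finite_nontrivial_heyting L"
  shows "covering_frame L (tree_frame L) prefix (fst \<circ> last)"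
proof unfold_locales
  show "finite_nontrivial_heyting L" by fact
  have distinct: "distinct s" if "sorted_wrt (\<lambda>x y. lat_le L (fst y) (fst x) \<and> fst y \<noteq> fst x) s" for s
    using that by (induction s) auto
  have "finite (join_primes L)"
    using fin by (auto simp: finite_nontrivial_heyting_def join_primes_def)
  then have "finite {s. set s \<subseteq> join_primes L \<times> (UNIV :: bool set) \<and> distinct s}"
    by (intro finite_subset_distinct) simp
  then show "finite (tree_frame L)"
    by (rule rev_finite_subset) (auto simp: tree_frame_def distinct)
  show "reflp_on (tree_frame L) prefix"
    by (auto intro: reflp_onI)
  show "transp_on (tree_frame L) prefix"
    by (auto intro: transp_onI prefix_order.trans)
  have prime: "fst (last s) \<in> join_primes L" if "s \<in> tree_frame L" for s
  proof -
    have "fst (last s) \<in> fst ` set s"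
      using that by (simp add: tree_frame_def)
    then show ?thesis
      using that by (auto simp: tree_frame_def)
  qed
  then have car: "fst (last s) \<in> carrier L" if "s \<in> tree_frame L" for s
    using that by (auto simp: join_primes_def)
  show "(fst \<circ> last) ` tree_frame L = join_primes L"
  proof safe
    fix p assume "p \<in> join_primes L"
    then have "[(p, True)] \<in> tree_frame L"
      by (simp add: tree_frame_def)
    then show "p \<in> (fst \<circ> last) ` tree_frame L"
      by (rule rev_image_eqI) simp
  qed (simp add: prime)
  show "(fst \<circ> last) t \<preceq> (fst \<circ> last) s" if st: "s \<in> tree_frame L" "t \<in> tree_frame L" "prefix s t" for s t
  proof -
    obtain u where t: "t = s @ u"
      using st(3) by (auto simp: prefix_def)
    show ?thesis
    proof (cases "u = []")
      case True
      then show ?thesis using t car [OF st(1)] by simp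
    next
      case False
      have "s \<noteq> []" using st(1) by (simp add: tree_frame_def)
      then show ?thesis
        using st(2) t False by (auto simp: tree_frame_def sorted_wrt_append)
    qed
  qed
  show "\<exists>t\<in>tree_frame L. prefix s t \<and> (fst \<circ> last) t = q"
    if s: "s \<in> tree_frame L" and q: "q \<in> join_primes L" "q \<preceq> (fst \<circ> last) s" for s q
  proof (cases "q = fst (last s)")
    case True
    then show ?thesis using s by (intro bexI [of _ s]) auto
  next
    case False
    have ne: "s \<noteq> []" using s by (simp add: tree_frame_def)
    have [simp]: "q \<in> carrier L" using q by (simp add: join_primes_def)
    \<comment> \<open>\<open>sorted_wrt\<close> constrains all pairs, so the appended prime must be
      compared with every entry of \<open>s\<close>, not just with the last.\<close>
    have "q \<preceq> fst x \<and> q \<noteq> fst x" if x: "x \<in> set s" for x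
    proof -
      have [simp]: "fst x \<in> carrier L" using s x by (auto simp: tree_frame_def join_primes_def)
      have "sorted_wrt (\<lambda>x y. lat_le L (fst y) (fst x) \<and> fst y \<noteq> fst x) (butlast s @ [last s])"
        using s ne by (simp add: tree_frame_def)
      moreover have "x \<in> set (butlast s) \<or> x = last s"
        using x ne by (metis append_butlast_last_id rotate1.simps(2) set_ConsD set_rotate1)
      ultimately have le: "fst (last s) \<preceq> fst x"
        using car [OF s] by (auto simp: sorted_wrt_append)
      then have "q \<preceq> fst x"
        using q car [OF s] le_trans by auto
      moreover have "q \<noteq> fst x"
        using le q car [OF s] False by (auto dest: le_antisym)
      ultimately show ?thesis by simp
    qed
    then have "s @ [(q, True)] \<in> tree_frame L"
      using s q by (simp add: tree_frame_def sorted_wrt_append)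
    then show ?thesis by (intro bexI [of _ "s @ [(q, True)]"]) auto
  qed
qed

text \<open>A world \<open>t\<close> not above \<open>s\<close> can avoid \<open>s\<close> forever.
  Either the two are incomparable and have no common extension, or \<open>t\<close> is a proper
  prefix of \<open>s\<close>, and flipping the tag of the next entry of \<open>s\<close> leads to a
  sibling branch that never meets the cone of \<open>s\<close>.\<close>

lemma tree_frame_upset_regular:
  assumes "s \<in> tree_frame L"
  shows "hneg (upset_algebra (tree_frame L) prefix)
    (hneg (upset_algebra (tree_frame L) prefix) {t \<in> tree_frame L. prefix s t}) = {t \<in> tree_frame L. prefix s t}"
proof -
  have "prefix s t"
    if t: "t \<in> tree_frame L"
      \<comment> \<open>This is membership of \<open>t\<close> in the double negation of the cone of
        \<open>s\<close>, unfolded.\<close>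
      and dense: "\<And>t'. t' \<in> tree_frame L \<Longrightarrow> prefix t t' \<Longrightarrow> \<exists>u\<in>tree_frame L. prefix t' u \<and> prefix s u" for t
  proof (rule ccontr)
    assume not: "\<not> prefix s t"
    then have "prefix t s"
      using dense [OF t] prefix_same_cases by blast
    with not obtain p b v where s: "s = t @ (p, b) # v"
      by (cases "drop (length t) s") (auto elim!: prefixE)
    then have "t @ [(p, \<not> b)] \<in> tree_frame L"
      using assms t by (auto simp: tree_frame_def sorted_wrt_append)
    then obtain u where "prefix (t @ [(p, \<not> b)]) u" "prefix s u"
      using dense [of "t @ [(p, \<not> b)]"] by auto
    then show False
      using s by (auto simp: prefix_def)
  qed
  then have "{t \<in> tree_frame L. \<forall>t'\<in>tree_frame L. prefix t t' \<longrightarrow>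
      (\<exists>u\<in>tree_frame L. prefix t' u \<and> prefix s u)} = {t \<in> tree_frame L. prefix s t}"
    by (intro Collect_cong conj_cong iffI) (auto intro: prefix_order.trans)
  moreover have "hneg (upset_algebra (tree_frame L) prefix)
      (hneg (upset_algebra (tree_frame L) prefix) {t \<in> tree_frame L. prefix s t}) =
    {t \<in> tree_frame L. \<forall>t'\<in>tree_frame L. prefix t t' \<longrightarrow> (\<exists>u\<in>tree_frame L. prefix t' u \<and> prefix s u)}"
    by auto
  ultimately show ?thesis
    by simp
qed

text \<open>In the tree extension, \<open>a\<close> becomes a finite up-set, that is, a finite union
  of cones. Each cone is regular, and \<open>e\<close> carries the union to a finite join in
  \<open>L\<close> of regular elements.\<close>

lemma fraisse_regular_hull:
  assumes L: "heyting_fraisse_limit L" and a: "a \<in> carrier L"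
  shows "\<exists>R. finite R \<and> R \<subseteq> carrier (regular_algebra L) \<and> a \<in> heyting_closed L hull R"
proof -
  interpret L: heyting_algebra L
    using L by (simp add: heyting_fraisse_limit_def)
  define A where "A = L\<lparr>carrier := heyting_closed L hull {a}\<rparr>"
  have A: "fg_substructure A L"
    using a by (auto simp: fg_substructure_def A_def)
  have aA: "a \<in> carrier A"
    by (simp add: A_def hull_inc)
  have "finite_nontrivial_heyting A"
    using L A unfolding heyting_fraisse_limit_def by blast
  then interpret covering_frame A "tree_frame A" prefix "fst \<circ> last"
    by (intro heyting_algebra.covering_frame_tree) (simp_all add: finite_nontrivial_heyting_def)
  let ?W = "upset_algebra (tree_frame A) prefix"
  let ?up = "\<lambda>s. {t \<in> tree_frame A. prefix s t}"
  obtain e where e: "e \<in> heyting_emb ?W L"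
    and ext: "\<And>a. a \<in> carrier A \<Longrightarrow> e {s \<in> tree_frame A. lat_le A ((fst \<circ> last) s) a} = a"
    using fraisse_frame_extension [OF L A covering_frame_axioms] by blast
  note eD = heyting_embD [OF e]
  have W: "heyting_algebra ?W"
    using heyting_algebra_upset_algebra refl trans .
  define U where "U = {s \<in> tree_frame A. lat_le A ((fst \<circ> last) s) a}"
  have U: "U \<subseteq> tree_frame A" "finite U"
    using finite_worlds by (auto simp: U_def)
  define R where "R = (\<lambda>s. e (?up s)) ` U"
  have up: "?up s \<in> carrier ?W" for s
    by (auto intro: prefix_order.trans)
  have "R \<subseteq> carrier (regular_algebra L)"
  proof -
    have "hneg L (hneg L (e (?up s))) = e (?up s)" if "s \<in> U" for s
    proof -
      have neg: "hneg ?W (?up s) \<in> carrier ?W"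
        using heyting_algebra.neg_closed [OF W up] .
      show ?thesis
        unfolding heyting_emb_hneg [OF e W up, symmetric] heyting_emb_hneg [OF e W neg, symmetric]
        using that U tree_frame_upset_regular [of s A] by auto
    qed
    then show ?thesis
      using eD(4) [OF up] by (auto simp: R_def regular_algebra_def)
  qed
  have "heyting_closed L (heyting_closed L hull R)"
    using \<open>R \<subseteq> _\<close> by (intro L.heyting_closed_hull) (auto simp: regular_algebra_def)
  then have hull: "lbot L \<in> heyting_closed L hull R"
    "\<And>x y. x \<in> heyting_closed L hull R \<Longrightarrow> y \<in> heyting_closed L hull R \<Longrightarrow> ljoin L x y \<in> heyting_closed L hull R"
    by (auto simp: heyting_closed_def)
  \<comment> \<open>Both \<open>e\<close> and the hull are only known to respect bottom and binary
    joins, so the union is built one cone at a time.\<close>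
  have "e (\<Union>s\<in>X. ?up s) \<in> heyting_closed L hull R" if "finite X" "X \<subseteq> U" for X
    using that
  proof (induction X)
    case empty
    then show ?case using eD(2) hull(1) by simp
  next
    case (insert s X)
    have "(\<Union>s\<in>X. ?up s) \<in> carrier ?W"
      using up by auto
    from eD(6) [OF up [of s] this] have "e (\<Union>s\<in>insert s X. ?up s) = ljoin L (e (?up s)) (e (\<Union>s\<in>X. ?up s))"
      by simp
    moreover have "e (?up s) \<in> heyting_closed L hull R"
      using insert.prems by (intro hull_inc) (auto simp: R_def)
    ultimately show ?case
      using insert hull(2) by simp
  qed
  from this [OF U(2) order_refl] have "e (\<Union>s\<in>U. ?up s) \<in> heyting_closed L hull R" .
  moreover have "(\<Union>s\<in>U. ?up s) = U"
  proof -
    have "U \<in> carrier ?W"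
      using heyting_embD(4) [OF frame_emb aA] by (simp add: U_def)
    then show ?thesis
      using U by auto
  qed
  ultimately have "a \<in> heyting_closed L hull R"
    using ext [OF aA] by (simp add: U_def)
  then show ?thesis
    using \<open>R \<subseteq> _\<close> U(2) by (intro exI [of _ R]) (simp add: R_def)
qed

section \<open>Twisting an automorphism along a regular element\<close>

lemma regular_algebra_simps:
  "carrier (regular_algebra L) = {a \<in> carrier L. hneg L (hneg L a) = a}"
  "lbot (regular_algebra L) = lbot L" "ltop (regular_algebra L) = ltop L"
  "lmeet (regular_algebra L) = lmeet L"
  "ljoin (regular_algebra L) a b = hneg L (hneg L (ljoin L a b))"
  "lcompl (regular_algebra L) = hneg L"
  by (simp_all add: regular_algebra_def)

text \<open>The double negation makes this a join in \<open>B\<close> rather than in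
  \<open>L\<close>. For regular arguments it is the regular element that looks like \<open>v\<close>
  below \<open>d\<close> and like \<open>w\<close> below the complement of \<open>d\<close>.\<close>

definition glue :: "'a heyting \<Rightarrow> 'a \<Rightarrow> 'a \<Rightarrow> 'a \<Rightarrow> 'a"
  where "glue L d v w = hneg L (hneg L (ljoin L (lmeet L v d) (lmeet L w (hneg L d))))"

context heyting_algebra
begin

lemma glue_closed [simp]:
  "\<lbrakk>v \<in> carrier L; w \<in> carrier L; d \<in> carrier L\<rbrakk> \<Longrightarrow> glue L d v w \<in> carrier L"
  by (simp add: glue_def)

lemma glue_regular [simp]:
  "\<lbrakk>v \<in> carrier L; w \<in> carrier L; d \<in> carrier L\<rbrakk> \<Longrightarrow> \<^bold>\<not> (\<^bold>\<not> (glue L d v w)) = glue L d v w"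
  by (simp add: glue_def)

lemma join_bot: "a \<in> carrier L \<Longrightarrow> a \<^bold>\<or> lbot L = a"
  by (metis bot_closed bot_least join_comm le_iff_join)

lemma meet_bot: "a \<in> carrier L \<Longrightarrow> a \<^bold>\<and> lbot L = lbot L"
  by (metis bot_closed bot_least lat_le_def meet_comm)

text \<open>Meeting with a regular \<open>d\<close> commutes with double negation, so the part
  disjoint from \<open>d\<close> is cut off before double negation can mix it in.\<close>

lemma negneg_disjoint_join_meet:
  assumes [simp]: "v \<in> carrier L" "w \<in> carrier L" "d \<in> carrier L"
    and reg: "\<^bold>\<not> (\<^bold>\<not> v) = v" "\<^bold>\<not> (\<^bold>\<not> d) = d" and disj: "w \<^bold>\<and> d = lbot L"
  shows "\<^bold>\<not> (\<^bold>\<not> (v \<^bold>\<and> d \<^bold>\<or> w)) \<^bold>\<and> d = v \<^bold>\<and> d"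
proof -
  have "\<^bold>\<not> (\<^bold>\<not> (v \<^bold>\<and> d \<^bold>\<or> w)) \<^bold>\<and> d = \<^bold>\<not> (\<^bold>\<not> ((v \<^bold>\<and> d \<^bold>\<or> w) \<^bold>\<and> d))"
    by (simp add: negneg_meet reg(2))
  also have "(v \<^bold>\<and> d \<^bold>\<or> w) \<^bold>\<and> d = v \<^bold>\<and> d"
    by (simp add: meet_join_distrib disj meet_assoc meet_idem join_bot)
  finally show ?thesis
    by (simp add: negneg_meet reg)
qed

lemma glue_meet:
  assumes [simp]: "v \<in> carrier L" "w \<in> carrier L" "d \<in> carrier L"
    and reg: "\<^bold>\<not> (\<^bold>\<not> v) = v" "\<^bold>\<not> (\<^bold>\<not> w) = w" "\<^bold>\<not> (\<^bold>\<not> d) = d"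
  shows "glue L d v w \<^bold>\<and> d = v \<^bold>\<and> d" "glue L d v w \<^bold>\<and> \<^bold>\<not> d = w \<^bold>\<and> \<^bold>\<not> d"
proof -
  have 1: "w \<^bold>\<and> \<^bold>\<not> d \<^bold>\<and> d = lbot L"
    by (simp add: meet_assoc meet_comm [of "\<^bold>\<not> d" d] meet_bot)
  show "glue L d v w \<^bold>\<and> d = v \<^bold>\<and> d"
    unfolding glue_def using 1 reg by (intro negneg_disjoint_join_meet) simp_all
  have 2: "v \<^bold>\<and> d \<^bold>\<and> \<^bold>\<not> d = lbot L"
    by (simp add: meet_assoc meet_bot)
  have "glue L d v w = \<^bold>\<not> (\<^bold>\<not> (w \<^bold>\<and> \<^bold>\<not> d \<^bold>\<or> v \<^bold>\<and> d))"
    by (simp add: glue_def join_comm)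
  then show "glue L d v w \<^bold>\<and> \<^bold>\<not> d = w \<^bold>\<and> \<^bold>\<not> d"
    using 2 reg by (simp add: negneg_disjoint_join_meet)
qed

text \<open>By \<open>regular_meet_cong\<close> the two traces determine a regular element. The
  homomorphism laws for \<open>glue\<close> thereby reduce to comparing traces.\<close>

lemma glue_unique:
  assumes "a \<^bold>\<and> d = v \<^bold>\<and> d" "a \<^bold>\<and> \<^bold>\<not> d = w \<^bold>\<and> \<^bold>\<not> d"
    and "a \<in> carrier L" "v \<in> carrier L" "w \<in> carrier L" "d \<in> carrier L"
    and "\<^bold>\<not> (\<^bold>\<not> a) = a" "\<^bold>\<not> (\<^bold>\<not> v) = v" "\<^bold>\<not> (\<^bold>\<not> w) = w" "\<^bold>\<not> (\<^bold>\<not> d) = d"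
  shows "glue L d v w = a"
  using assms by (rule_tac d = d in regular_meet_cong) (simp_all add: glue_meet)

lemma meet_meet_distrib:
  assumes "a \<in> carrier L" "b \<in> carrier L" "c \<in> carrier L"
  shows "(a \<^bold>\<and> b) \<^bold>\<and> c = (a \<^bold>\<and> c) \<^bold>\<and> (b \<^bold>\<and> c)"
  using assms by (simp add: meet_assoc meet_comm [of c "b \<^bold>\<and> c"] meet_idem)

lemma glue_meet_hom:
  assumes [simp]: "v \<in> carrier L" "w \<in> carrier L" "v' \<in> carrier L" "w' \<in> carrier L" "d \<in> carrier L"
    and reg: "\<^bold>\<not> (\<^bold>\<not> v) = v" "\<^bold>\<not> (\<^bold>\<not> w) = w" "\<^bold>\<not> (\<^bold>\<not> v') = v'" "\<^bold>\<not> (\<^bold>\<not> w') = w'" "\<^bold>\<not> (\<^bold>\<not> d) = d"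
  shows "glue L d (v \<^bold>\<and> v') (w \<^bold>\<and> w') = glue L d v w \<^bold>\<and> glue L d v' w'"
  by (rule glue_unique)
    (simp_all add: meet_meet_distrib [of _ _ d] meet_meet_distrib [of _ _ "\<^bold>\<not> d"] glue_meet reg negneg_meet)

lemma glue_neg_hom:
  assumes [simp]: "v \<in> carrier L" "w \<in> carrier L" "d \<in> carrier L"
    and reg: "\<^bold>\<not> (\<^bold>\<not> v) = v" "\<^bold>\<not> (\<^bold>\<not> w) = w" "\<^bold>\<not> (\<^bold>\<not> d) = d"
  shows "glue L d (\<^bold>\<not> v) (\<^bold>\<not> w) = \<^bold>\<not> (glue L d v w)"
proof (rule glue_unique)
  have "\<^bold>\<not> (glue L d v w) \<^bold>\<and> d = \<^bold>\<not> (glue L d v w \<^bold>\<and> d) \<^bold>\<and> d"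
    by (simp add: meet_neg_meet)
  also have "\<dots> = \<^bold>\<not> v \<^bold>\<and> d"
    by (simp add: glue_meet reg meet_neg_meet)
  finally show "\<^bold>\<not> (glue L d v w) \<^bold>\<and> d = \<^bold>\<not> v \<^bold>\<and> d" .
  have "\<^bold>\<not> (glue L d v w) \<^bold>\<and> \<^bold>\<not> d = \<^bold>\<not> (glue L d v w \<^bold>\<and> \<^bold>\<not> d) \<^bold>\<and> \<^bold>\<not> d"
    by (simp add: meet_neg_meet)
  also have "\<dots> = \<^bold>\<not> w \<^bold>\<and> \<^bold>\<not> d"
    by (simp add: glue_meet reg meet_neg_meet)
  finally show "\<^bold>\<not> (glue L d v w) \<^bold>\<and> \<^bold>\<not> d = \<^bold>\<not> w \<^bold>\<and> \<^bold>\<not> d" .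
qed (simp_all add: reg)

section \<open>Action of automorphisms on the regular elements\<close>

lemma heyting_aut_hneg:
  "\<lbrakk>f \<in> heyting_aut L; a \<in> carrier L\<rbrakk> \<Longrightarrow> f (\<^bold>\<not> a) = \<^bold>\<not> (f a)"
  using heyting_emb_hneg heyting_aut_emb heyting_algebra_axioms by metis

lemma heyting_aut_regular_iff:
  assumes f: "f \<in> heyting_aut L" and a: "a \<in> carrier L"
  shows "f a \<in> carrier (regular_algebra L) \<longleftrightarrow> a \<in> carrier (regular_algebra L)"
proof -
  note fD = heyting_embD [OF heyting_aut_emb [OF f]]
  have "\<^bold>\<not> (\<^bold>\<not> (f a)) = f (\<^bold>\<not> (\<^bold>\<not> a))"
    using a by (simp add: heyting_aut_hneg [OF f])
  then show ?thesis
    using a fD(1,4) by (auto simp: regular_algebra_simps inj_on_def)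
qed

lemma regular_image:
  assumes f: "f \<in> heyting_aut L"
  shows "f ` carrier (regular_algebra L) = carrier (regular_algebra L)"
proof -
  note iff = heyting_aut_regular_iff [OF f]
  have BL: "carrier (regular_algebra L) \<subseteq> carrier L"
    by (auto simp: regular_algebra_simps)
  have "f ` carrier L = carrier L"
    using f by (simp add: heyting_aut_def heyting_iso_iff)
  then have surj: "\<exists>v\<in>carrier L. f v = w" if "w \<in> carrier L" for w
    using that by (metis imageE)
  show ?thesis
  proof (intro equalityI subsetI)
    fix w assume w: "w \<in> carrier (regular_algebra L)"
    then obtain v where v: "v \<in> carrier L" "w = f v"
      using surj BL by blast
    with w iff [of v] show "w \<in> f ` carrier (regular_algebra L)"
      by simp
  next
    fix w assume "w \<in> f ` carrier (regular_algebra L)"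
    then show "w \<in> carrier (regular_algebra L)"
      using BL iff by auto
  qed
qed

text \<open>Top is the negation of bottom, and the join of \<open>B\<close> is given by De Morgan
  from meet and negation, so preservation of these two follows from the rest.\<close>

lemma boolean_autI:
  assumes bij: "bij_betw g (carrier (regular_algebra L)) (carrier (regular_algebra L))"
    and bot: "g (lbot L) = lbot L"
    and meet: "\<And>u v. \<lbrakk>u \<in> carrier (regular_algebra L); v \<in> carrier (regular_algebra L)\<rbrakk> \<Longrightarrow> g (u \<^bold>\<and> v) = g u \<^bold>\<and> g v"
    and neg: "\<And>u. u \<in> carrier (regular_algebra L) \<Longrightarrow> g (\<^bold>\<not> u) = \<^bold>\<not> (g u)"
  shows "restrict g (carrier (regular_algebra L)) \<in> boolean_aut (regular_algebra L)"
proof -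
  let ?B = "carrier (regular_algebra L)"
  have cl: "lbot L \<in> ?B" "ltop L \<in> ?B" "\<And>u v. u \<in> ?B \<Longrightarrow> v \<in> ?B \<Longrightarrow> u \<^bold>\<and> v \<in> ?B" "\<And>u. u \<in> ?B \<Longrightarrow> \<^bold>\<not> u \<in> ?B"
    by (auto simp: regular_algebra_simps neg_bot neg_top negneg_meet)
  have gB: "g u \<in> ?B" if "u \<in> ?B" for u
    using bij that by (auto simp: bij_betw_def)
  have top: "g (ltop L) = ltop L"
    using neg [OF cl(1)] bot by (simp add: neg_bot)
  have BL: "u \<in> carrier L" if "u \<in> ?B" for u
    using that by (simp add: regular_algebra_simps)
  have join_eq: "\<^bold>\<not> (\<^bold>\<not> (u \<^bold>\<or> v)) = \<^bold>\<not> (\<^bold>\<not> u \<^bold>\<and> \<^bold>\<not> v)" if "u \<in> ?B" "v \<in> ?B" for u v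
    using that BL by (simp add: neg_join)
  have join: "g (\<^bold>\<not> (\<^bold>\<not> (u \<^bold>\<or> v))) = \<^bold>\<not> (\<^bold>\<not> (g u \<^bold>\<or> g v))" if "u \<in> ?B" "v \<in> ?B" for u v
    using that by (simp add: join_eq gB cl neg meet)
  have joinB: "\<^bold>\<not> (\<^bold>\<not> (u \<^bold>\<or> v)) \<in> ?B" if "u \<in> ?B" "v \<in> ?B" for u v
    using that by (simp add: join_eq cl)
  have "bij_betw (restrict g ?B) ?B ?B"
    using bij by (simp cong: bij_betw_cong)
  then show ?thesis
    using cl joinB
    by (simp add: boolean_aut_def boolean_iso_def bounded_lat_iso_def Bij_def
        regular_algebra_simps(2-6) bot top meet neg join)
qed

text \<open>\<open>B\<close> splits as a product of the intervals below \<open>d\<close> and below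
  its complement. As \<open>f\<close> fixes \<open>d\<close>, it permutes the regular elements below
  \<open>d\<close>, and it may be combined with the identity on the other factor.\<close>

lemma twist_boolean_aut:
  assumes f: "f \<in> heyting_aut L" and d: "d \<in> carrier (regular_algebra L)" "f d = d"
  shows "(\<lambda>u\<in>carrier (regular_algebra L). glue L d (f u) u) \<in> boolean_aut (regular_algebra L)"
proof (rule boolean_autI)
  let ?B = "carrier (regular_algebra L)"
  note fD = heyting_embD [OF heyting_aut_emb [OF f]]
  have dL [simp]: "d \<in> carrier L" and d_reg: "\<^bold>\<not> (\<^bold>\<not> d) = d"
    using d by (simp_all add: regular_algebra_simps)
  have B: "u \<in> carrier L" "\<^bold>\<not> (\<^bold>\<not> u) = u" "f u \<in> carrier L" "\<^bold>\<not> (\<^bold>\<not> (f u)) = f u" if "u \<in> ?B" for u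
    using that heyting_aut_regular_iff [OF f, of u] by (auto simp: regular_algebra_simps)
  show "glue L d (f (u \<^bold>\<and> v)) (u \<^bold>\<and> v) = glue L d (f u) u \<^bold>\<and> glue L d (f v) v"
    if "u \<in> ?B" "v \<in> ?B" for u v
    using that B d_reg by (simp add: fD(5) glue_meet_hom)
  show "glue L d (f (\<^bold>\<not> u)) (\<^bold>\<not> u) = \<^bold>\<not> (glue L d (f u) u)" if "u \<in> ?B" for u
    using that B d_reg by (simp add: heyting_aut_hneg [OF f] glue_neg_hom)
  show "glue L d (f (lbot L)) (lbot L) = lbot L"
    using d_reg by (intro glue_unique) (simp_all add: fD(2) neg_bot neg_top)
  have meet_d: "f u \<^bold>\<and> d = f (u \<^bold>\<and> d)" if "u \<in> carrier L" for u
    using that d(2) by (simp add: fD(5))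
  have "inj_on (\<lambda>u. glue L d (f u) u) ?B"
  proof (rule inj_onI)
    fix u v assume uv: "u \<in> ?B" "v \<in> ?B" and eq: "glue L d (f u) u = glue L d (f v) v"
    have "f u \<^bold>\<and> d = f v \<^bold>\<and> d" "u \<^bold>\<and> \<^bold>\<not> d = v \<^bold>\<and> \<^bold>\<not> d"
      using eq uv B d_reg by (metis dL glue_meet)+
    then have "u \<^bold>\<and> d = v \<^bold>\<and> d"
      using uv B fD(1) by (simp add: meet_d inj_on_def)
    with \<open>u \<^bold>\<and> \<^bold>\<not> d = v \<^bold>\<and> \<^bold>\<not> d\<close> show "u = v"
      using uv B by (rule_tac d = d in regular_meet_cong) simp_all
  qed
  moreover have "glue L d (f u) u \<in> ?B" if "u \<in> ?B" for u
    using B [OF that] by (simp add: regular_algebra_simps)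
  moreover have "\<exists>u\<in>?B. glue L d (f u) u = w" if w: "w \<in> ?B" for w
  proof -
    obtain v where v: "v \<in> ?B" "f v = w"
      using w regular_image [OF f] by (metis imageE)
    \<comment> \<open>The preimage of \<open>w\<close>: below \<open>d\<close> it is the
      \<open>f\<close>-preimage of \<open>w\<close>, below the complement it is \<open>w\<close>
      itself.\<close>
    define u where "u = glue L d v w"
    have u: "u \<in> ?B" and uv: "u \<^bold>\<and> d = v \<^bold>\<and> d" "u \<^bold>\<and> \<^bold>\<not> d = w \<^bold>\<and> \<^bold>\<not> d"
      using B [OF v(1)] B [OF w] d_reg by (simp_all add: u_def glue_meet regular_algebra_simps)
    have "f u \<^bold>\<and> d = w \<^bold>\<and> d"
      using uv(1) u v B by (metis meet_d)
    then have "glue L d (f u) u = w"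
      using uv(2) B [OF u] B [OF w] d_reg by (intro glue_unique) simp_all
    then show ?thesis using u by blast
  qed
  ultimately show "bij_betw (\<lambda>u. glue L d (f u) u) ?B ?B"
    unfolding bij_betw_def by blast
qed

end

text \<open>The frame \<open>{False, True} \<times> {None, Some False, Some True}\<close> consists of two copies of a root with
  two leaves above it.\<close>

definition fork_le :: "'a heyting \<Rightarrow> 'a \<times> bool \<times> bool option \<Rightarrow> 'a \<times> bool \<times> bool option \<Rightarrow> bool"
  where "fork_le L = (\<lambda>(p, c, l) (q, c', l'). lat_le L q p \<and> c = c' \<and> (l = None \<or> l = l'))"

definition fork_swap :: "'a \<times> bool \<times> bool option \<Rightarrow> 'a \<times> bool \<times> bool option"
  where "fork_swap = (\<lambda>(p, c, l). (p, \<not> c, l))"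

text \<open>The order is a product order, so a step down in the first coordinate lifts with the fork
  coordinate unchanged.\<close>

lemma (in heyting_algebra) covering_frame_fork:
  assumes "finite_nontrivial_heyting L"
  shows "covering_frame L (join_primes L \<times> UNIV) (fork_le L) fst"
proof unfold_locales
  show "finite_nontrivial_heyting L" by fact
  have "finite (join_primes L)"
    using assms by (auto simp: finite_nontrivial_heyting_def join_primes_def)
  then show "finite (join_primes L \<times> (UNIV :: (bool \<times> bool option) set))"
    by simp
  have car: "p \<in> carrier L" if "p \<in> join_primes L" for p
    using that by (simp add: join_primes_def)
  show "reflp_on (join_primes L \<times> UNIV) (fork_le L)"
    by (rule reflp_onI) (auto simp: fork_le_def car)
  show "transp_on (join_primes L \<times> UNIV) (fork_le L)"
    by (rule transp_onI) (auto simp: fork_le_def intro: le_trans car)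
qed (auto simp: fork_le_def)

text \<open>Symmetries of a frame act on its up-sets. Surjectivity of \<open>g\<close> lets the
  quantifier over worlds in an implication be reindexed along \<open>g\<close>.\<close>

lemma heyting_emb_vimage:
  assumes "bij_betw g W W" and r: "\<And>s t. \<lbrakk>s \<in> W; t \<in> W\<rbrakk> \<Longrightarrow> r (g s) (g t) \<longleftrightarrow> r s t"
  shows "(\<lambda>U. {s \<in> W. g s \<in> U}) \<in> heyting_emb (upset_algebra W r) (upset_algebra W r)"
proof -
  have g: "g s \<in> W" if "s \<in> W" for s
    using assms(1) that by (auto simp: bij_betw_def)
  have surj: "(\<forall>t\<in>W. P t) \<longleftrightarrow> (\<forall>t\<in>W. P (g t))" for P
  proof -
    have "(\<forall>t\<in>g ` W. P t) \<longleftrightarrow> (\<forall>t\<in>W. P (g t))" by blast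
    then show ?thesis
      unfolding bij_betw_imp_surj_on [OF assms(1)] .
  qed
  have "inj_on (\<lambda>U. {s \<in> W. g s \<in> U}) (carrier (upset_algebra W r))"
  proof (rule inj_onI)
    fix U V assume UV: "U \<in> carrier (upset_algebra W r)" "V \<in> carrier (upset_algebra W r)"
      and "{s \<in> W. g s \<in> U} = {s \<in> W. g s \<in> V}"
    then have "\<forall>t\<in>W. g t \<in> U \<longleftrightarrow> g t \<in> V" by blast
    then have "\<forall>t\<in>W. t \<in> U \<longleftrightarrow> t \<in> V"
      using surj [of "\<lambda>t. t \<in> U \<longleftrightarrow> t \<in> V"] by simp
    then show "U = V" using UV by auto
  qed
  moreover have "{s \<in> W. g s \<in> {s \<in> W. \<forall>t\<in>W. r s t \<longrightarrow> t \<in> U \<longrightarrow> t \<in> V}} =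
      {s \<in> W. \<forall>t\<in>W. r s t \<longrightarrow> t \<in> {s \<in> W. g s \<in> U} \<longrightarrow> t \<in> {s \<in> W. g s \<in> V}}" for U V
    using surj [of "\<lambda>t. r (g s) t \<longrightarrow> t \<in> U \<longrightarrow> t \<in> V" for s] by (auto simp: g r)
  moreover have "{s \<in> W. g s \<in> U} \<in> carrier (upset_algebra W r)" if "U \<in> carrier (upset_algebra W r)" for U
    using that g r by auto
  ultimately show ?thesis
    by (auto simp: heyting_emb_def g)
qed

text \<open>On blocks negation acts only on the fork coordinate, since each world sees the same join
  prime over every fork position it can reach. Calculations thus take place in the six-element
  frame, where a root sees its own two leaves.\<close>

lemma hneg_fork_block:
  fixes L :: "'a heyting"
  assumes "heyting_algebra L"
  shows "hneg (upset_algebra (join_primes L \<times> UNIV) (fork_le L)) (join_primes L \<times> Z) =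
    join_primes L \<times> {(c, l). (c, l) \<notin> Z \<and> (l = None \<longrightarrow> (c, Some True) \<notin> Z \<and> (c, Some False) \<notin> Z)}"
proof -
  have refl: "lat_le L p p" if "p \<in> join_primes L" for p
    using that heyting_algebra.le_refl [OF assms] by (simp add: join_primes_def)
  have "(\<forall>t\<in>join_primes L \<times> UNIV. fork_le L (p, c, l) t \<longrightarrow> t \<notin> join_primes L \<times> Z) \<longleftrightarrow>
      (c, l) \<notin> Z \<and> (l = None \<longrightarrow> (c, Some True) \<notin> Z \<and> (c, Some False) \<notin> Z)" (is "?l \<longleftrightarrow> ?r")
    if "p \<in> join_primes L" for p c l
  proof
    assume ?l
    then have "fork_le L (p, c, l) (p, c, l') \<longrightarrow> (c, l') \<notin> Z" for l'
      using that by blast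
    then show ?r
      using refl [OF that] by (simp add: fork_le_def)
  next
    assume r: ?r
    show ?l
    proof clarsimp
      fix q c' l' assume "fork_le L (p, c, l) (q, c', l')" "(c', l') \<in> Z"
      with r show False
        by (cases l'; cases "the l'") (auto simp: fork_le_def)
    qed
  qed
  note eq = this
  show ?thesis
  proof (rule Set.set_eqI)
    fix s :: "'a \<times> bool \<times> bool option"
    obtain p c l where s: "s = (p, c, l)" by (cases s)
    show "s \<in> hneg (upset_algebra (join_primes L \<times> UNIV) (fork_le L)) (join_primes L \<times> Z) \<longleftrightarrow>
        s \<in> join_primes L \<times> {(c, l). (c, l) \<notin> Z \<and> (l = None \<longrightarrow> (c, Some True) \<notin> Z \<and> (c, Some False) \<notin> Z)}"
      using eq [of p c l] unfolding s by (cases "p \<in> join_primes L") simp_all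
  qed
qed

text \<open>Complementedness in \<open>L\<close> is the invariant that the twist will destroy. The
  witnesses are computed as blocks of the fork extension of the algebra generated by
  \<open>F\<close> and transported by \<open>e\<close>.\<close>

lemma fraisse_swap:
  assumes L: "heyting_fraisse_limit L" and F: "finite F" "F \<subseteq> carrier L"
  shows "\<exists>f\<in>heyting_aut L. \<exists>d\<in>carrier (regular_algebra L). \<exists>x\<in>carrier L.
    (\<forall>a\<in>F. f a = a) \<and> f d = d \<and> ljoin L x (hneg L x) = ltop L \<and>
    ljoin L (glue L d (f x) x) (hneg L (glue L d (f x) x)) \<noteq> ltop L"
proof -
  interpret L: heyting_algebra L
    using L by (simp add: heyting_fraisse_limit_def)
  define A where "A = L\<lparr>carrier := heyting_closed L hull F\<rparr>"
  have A: "fg_substructure A L"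
    using F by (auto simp: fg_substructure_def A_def)
  have FA: "F \<subseteq> carrier A"
    by (simp add: A_def hull_subset)
  have fin: "finite_nontrivial_heyting A"
    using L A unfolding heyting_fraisse_limit_def by blast
  then interpret covering_frame A "join_primes A \<times> UNIV" "fork_le A" fst
    by (intro heyting_algebra.covering_frame_fork) (simp_all add: finite_nontrivial_heyting_def)
  let ?J = "join_primes A"
  let ?W = "upset_algebra (?J \<times> UNIV) (fork_le A)"
  obtain e where e: "e \<in> heyting_emb ?W L"
    and ext: "\<And>a. a \<in> carrier A \<Longrightarrow> e {s \<in> ?J \<times> UNIV. lat_le A (fst s) a} = a"
    using fraisse_frame_extension [OF L A covering_frame_axioms] by blast
  note eD = heyting_embD [OF e]
  have W: "heyting_algebra ?W" and Wfin: "finite (carrier ?W)"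
    using finite_nontrivial_frame by (auto simp: finite_nontrivial_heyting_def)
  interpret W: heyting_algebra ?W by (rule W)
  let ?swap = "\<lambda>U. {s \<in> ?J \<times> UNIV. fork_swap s \<in> U}"
  have "bij_betw fork_swap (?J \<times> UNIV) (?J \<times> UNIV)"
    by (rule bij_betwI [of _ _ _ fork_swap]) (auto simp: fork_swap_def)
  then have "?swap \<in> heyting_emb ?W ?W"
    by (rule heyting_emb_vimage) (auto simp: fork_le_def fork_swap_def)
  then have "e \<circ> ?swap \<in> heyting_emb ?W L"
    using e by (rule heyting_emb_comp)
  \<comment> \<open>\<open>e\<close> and its composite with the swap are two embeddings of one
    finite algebra, so homogeneity realises the swap by an automorphism of \<open>L\<close>.\<close>
  from fraisse_emb_conjugate [OF L W Wfin e this]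
  obtain f where f: "f \<in> heyting_aut L" and "\<forall>U\<in>carrier ?W. f (e U) = (e \<circ> ?swap) U" ..
  then have fe: "f (e U) = e (?swap U)" if "U \<in> carrier ?W" for U
    using that by (simp only: o_apply)
  have blockI: "?J \<times> Z \<in> carrier ?W" if "\<And>c l. (c, None) \<in> Z \<Longrightarrow> (c, l) \<in> Z" for Z
    using that by (auto simp: fork_le_def)
  have swap_block: "?swap (?J \<times> Z) = ?J \<times> {(c, l). (\<not> c, l) \<in> Z}" for Z
    by (auto simp: fork_swap_def)
  \<comment> \<open>\<open>D\<close> takes the \<open>Some False\<close> leaf of both copies and is
    invariant under the swap. \<open>X\<close> is the whole copy \<open>False\<close>.
    \<open>Y\<close> consists of opposite leaves: \<open>Some True\<close> in copy
    \<open>False\<close> and \<open>Some False\<close> in copy \<open>True\<close>.\<close>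
  define D where "D = ?J \<times> {(c :: bool, l). l = Some False}"
  define X where "X = ?J \<times> {(c, l :: bool option). \<not> c}"
  define Y where "Y = ?J \<times> {(c, l). l = Some (\<not> c)}"
  have DW: "D \<in> carrier ?W" and XW: "X \<in> carrier ?W" and YW: "Y \<in> carrier ?W"
    unfolding D_def X_def Y_def by (rule blockI; simp)+
  note block = hneg_fork_block [OF heyting_algebra_axioms]
  have negD: "hneg ?W D = ?J \<times> {(c, l). l = Some True}"
    unfolding D_def block by (rule Set.set_eqI, rename_tac s, case_tac s, rename_tac p c l, case_tac l, auto)
  have negnegD: "hneg ?W (hneg ?W D) = D"
    unfolding negD unfolding D_def block by (rule Set.set_eqI, rename_tac s, case_tac s, rename_tac p c l, case_tac l, auto)
  have negX: "hneg ?W X = ?J \<times> {(c, l). c}"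
    unfolding X_def block by auto
  have swapD: "?swap D = D" and swapX: "?swap X = ?J \<times> {(c, l). c}"
    unfolding D_def X_def swap_block by auto
  have "glue ?W D (?swap X) X = Y"
  proof -
    have eq: "?swap X \<inter> D \<union> X \<inter> hneg ?W D = Y"
      unfolding swapX negD by (auto simp: X_def D_def Y_def)
    have "hneg ?W Y = ?J \<times> {(c, l). l = Some c}"
      unfolding Y_def block by (rule Set.set_eqI, rename_tac s, case_tac s, rename_tac p c l, case_tac l, auto)
    moreover have "hneg ?W (?J \<times> {(c, l). l = Some c}) = Y"
      unfolding Y_def block by (rule Set.set_eqI, rename_tac s, case_tac s, rename_tac p c l, case_tac l, auto)
    ultimately show ?thesis
      using eq by (simp add: glue_def del: upset_algebra_simps(7))
  qed
  moreover have "e (glue ?W D (?swap X) X) = glue L (e D) (e (?swap X)) (e X)"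
  proof -
    have "?swap X \<in> carrier ?W"
      unfolding swapX by (rule blockI) simp
    then show ?thesis
      using DW XW unfolding glue_def
      by (simp add: heyting_emb_hneg [OF e W] eD(5,6) W.meet_closed W.join_closed W.neg_closed
          del: upset_algebra_simps)
  qed
  ultimately have glueY: "glue L (e D) (f (e X)) (e X) = e Y"
    using fe [OF XW] by simp
  have "ljoin ?W X (hneg ?W X) = ltop ?W"
    unfolding negX by (auto simp: X_def)
  then have "ljoin L (e X) (hneg L (e X)) = ltop L"
    using eD(3) XW by (simp flip: heyting_emb_hneg [OF e W] eD(6) del: upset_algebra_simps)
  \<comment> \<open>Each root sees one leaf in \<open>Y\<close> and one in its negation, so it
    belongs to neither up-set.\<close>
  moreover have "ljoin ?W Y (hneg ?W Y) \<noteq> ltop ?W"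
  proof -
    obtain p where "p \<in> ?J"
      using finite_nontrivial_frame surj by (force simp: finite_nontrivial_heyting_def)
    then have "(p, True, None) \<in> ltop ?W" "(p, True, None) \<notin> ljoin ?W Y (hneg ?W Y)"
      unfolding Y_def block by auto
    then show ?thesis by blast
  qed
  then have "e (ljoin ?W Y (hneg ?W Y)) \<noteq> e (ltop ?W)"
    using inj_on_eq_iff [OF eD(1) W.join_closed [OF YW W.neg_closed [OF YW]] W.top_closed] by blast
  then have "ljoin L (e Y) (hneg L (e Y)) \<noteq> ltop L"
    unfolding eD(3) eD(6) [OF YW W.neg_closed [OF YW]] heyting_emb_hneg [OF e W YW] .
  moreover have "f (e D) = e D"
    using fe [OF DW] swapD by simp
  moreover have "e D \<in> carrier (regular_algebra L)"
    using DW negnegD eD(4)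
    by (simp add: regular_algebra_simps W.neg_closed del: upset_algebra_simps flip: heyting_emb_hneg [OF e W])
  \<comment> \<open>The up-set representing \<open>a\<close> does not mention the fork coordinate,
    hence the swap leaves it unchanged.\<close>
  moreover have "f a = a" if "a \<in> F" for a
  proof -
    have a: "a \<in> carrier A" using that FA by blast
    have "f (e {s \<in> ?J \<times> UNIV. lat_le A (fst s) a}) = e (?swap {s \<in> ?J \<times> UNIV. lat_le A (fst s) a})"
      using heyting_embD(4) [OF frame_emb a] by (rule fe)
    also have "?swap {s \<in> ?J \<times> UNIV. lat_le A (fst s) a} = {s \<in> ?J \<times> UNIV. lat_le A (fst s) a}"
      by (auto simp: fork_swap_def)
    finally show ?thesis
      using ext [OF a] by simp
  qed
  ultimately show ?thesis
    using f eD(4) [OF XW] glueY by (intro bexI [of _ f] bexI [of _ "e D"] bexI [of _ "e X"]) auto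
qed

section \<open>Topology of the automorphism groups\<close>

text \<open>A basic open box is proper in finitely many coordinates only, and these form
  \<open>F\<close>. Conversely, the box with singleton factors on \<open>F\<close> and full factors
  elsewhere pins down the values on \<open>F\<close>.\<close>

lemma openin_pointwise_topology:
  assumes G: "G \<subseteq> S \<rightarrow>\<^sub>E S"
  shows "openin (pointwise_topology S G) U \<longleftrightarrow>
    U \<subseteq> G \<and> (\<forall>f\<in>U. \<exists>F. finite F \<and> F \<subseteq> S \<and> (\<forall>g\<in>G. (\<forall>x\<in>F. g x = f x) \<longrightarrow> g \<in> U))"
    (is "?lhs \<longleftrightarrow> ?rhs")
proof
  let ?P = "product_topology (\<lambda>_. discrete_topology S) S"
  assume ?lhs
  then obtain T where T: "openin ?P T" "U = T \<inter> G"
    by (auto simp: pointwise_topology_def openin_subtopology)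
  have "\<exists>F. finite F \<and> F \<subseteq> S \<and> (\<forall>g\<in>G. (\<forall>x\<in>F. g x = f x) \<longrightarrow> g \<in> U)" if "f \<in> U" for f
  proof -
    have "f \<in> T" using that T by simp
    then obtain V where V: "finite {i \<in> S. V i \<noteq> S}" "f \<in> Pi\<^sub>E S V" "Pi\<^sub>E S V \<subseteq> T"
      using T(1) unfolding openin_product_topology_alt by auto
    have "g \<in> Pi\<^sub>E S V" if "g \<in> G" "\<forall>x\<in>{i \<in> S. V i \<noteq> S}. g x = f x" for g
    proof (rule PiE_I)
      fix i assume "i \<in> S"
      then show "g i \<in> V i"
        using that G V(2) by (cases "V i = S") (auto dest: PiE_mem)
    next
      fix i assume "i \<notin> S"
      then show "g i = undefined"
        using that G by (auto dest: PiE_arb)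
    qed
    then have "\<forall>g\<in>G. (\<forall>x\<in>{i \<in> S. V i \<noteq> S}. g x = f x) \<longrightarrow> g \<in> U"
      using V(3) T(2) by blast
    then show ?thesis
      using V(1) by (intro exI [of _ "{i \<in> S. V i \<noteq> S}"]) blast
  qed
  then show ?rhs using T by auto
next
  let ?P = "product_topology (\<lambda>_. discrete_topology S) S"
  assume rhs: ?rhs
  have "\<exists>T. openin (pointwise_topology S G) T \<and> f \<in> T \<and> T \<subseteq> U" if f: "f \<in> U" for f
  proof -
    obtain F where F: "finite F" "F \<subseteq> S" "\<forall>g\<in>G. (\<forall>x\<in>F. g x = f x) \<longrightarrow> g \<in> U"
      using rhs f by blast
    have fG: "f \<in> G" "f \<in> S \<rightarrow>\<^sub>E S" using rhs f G by auto
    let ?V = "\<lambda>i. if i \<in> F then {f i} else S"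
    have "finite {i \<in> S. ?V i \<noteq> S}"
      by (rule finite_subset [OF _ F(1)]) auto
    then have "openin ?P (Pi\<^sub>E S ?V)"
      using fG(2) by (auto simp: openin_PiE_gen dest: PiE_mem)
    then have "openin (pointwise_topology S G) (G \<inter> Pi\<^sub>E S ?V)"
      by (simp add: pointwise_topology_def openin_subtopology_Int2)
    moreover have "f \<in> G \<inter> Pi\<^sub>E S ?V"
      using fG by (auto simp: PiE_iff)
    moreover have "G \<inter> Pi\<^sub>E S ?V \<subseteq> U"
    proof
      fix g assume g: "g \<in> G \<inter> Pi\<^sub>E S ?V"
      have "g x = f x" if "x \<in> F" for x
        using g that F(2) PiE_mem [of g S ?V x] by auto
      then show "g \<in> U" using F(3) g by blast
    qed
    ultimately show ?thesis by blast
  qed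
  then show ?lhs
    by (subst openin_subopen) blast
qed

lemma Bij_PiE: "G \<subseteq> Bij S \<Longrightarrow> G \<subseteq> S \<rightarrow>\<^sub>E S"
  by (auto simp: Bij_def PiE_def bij_betw_def)

lemma subtopology_pointwise_topology:
  assumes "H \<subseteq> G"
  shows "subtopology (pointwise_topology S G) H = pointwise_topology S H"
  using assms by (simp add: pointwise_topology_def subtopology_subtopology Int_absorb1)

lemma openin_heyting_aut_topology:
  "openin (heyting_aut_topology L) U \<longleftrightarrow> U \<subseteq> heyting_aut L \<and>
    (\<forall>f\<in>U. \<exists>F. finite F \<and> F \<subseteq> carrier L \<and> (\<forall>g\<in>heyting_aut L. (\<forall>x\<in>F. g x = f x) \<longrightarrow> g \<in> U))"
  by (intro openin_pointwise_topology Bij_PiE) (simp add: heyting_aut_def)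

lemma openin_boolean_aut_topology:
  "openin (boolean_aut_topology B) U \<longleftrightarrow> U \<subseteq> boolean_aut B \<and>
    (\<forall>f\<in>U. \<exists>F. finite F \<and> F \<subseteq> carrier B \<and> (\<forall>g\<in>boolean_aut B. (\<forall>x\<in>F. g x = f x) \<longrightarrow> g \<in> U))"
  by (intro openin_pointwise_topology Bij_PiE) (simp add: boolean_aut_def)

section \<open>Restriction to the regular elements\<close>

context heyting_algebra
begin

lemma h_negneg_boolean_aut:
  assumes f: "f \<in> heyting_aut L"
  shows "h_negneg L f \<in> boolean_aut (regular_algebra L)"
  unfolding h_negneg_def
proof (rule boolean_autI)
  note fD = heyting_embD [OF heyting_aut_emb [OF f]]
  show "f (lbot L) = lbot L" by (rule fD(2))
  have "inj_on f (carrier (regular_algebra L))"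
    using fD(1) by (rule inj_on_subset) (auto simp: regular_algebra_simps)
  then show "bij_betw f (carrier (regular_algebra L)) (carrier (regular_algebra L))"
    using regular_image [OF f] by (simp add: bij_betw_def)
qed (use f heyting_embD(5) [OF heyting_aut_emb [OF f]] in \<open>simp_all add: heyting_aut_hneg regular_algebra_simps\<close>)

lemma h_negneg_hom: "h_negneg L \<in> hom (heyting_AutoGroup L) (boolean_AutoGroup (regular_algebra L))"
proof (rule homI)
  fix f assume "f \<in> carrier (heyting_AutoGroup L)"
  then show "h_negneg L f \<in> carrier (boolean_AutoGroup (regular_algebra L))"
    by (simp add: heyting_AutoGroup_def boolean_AutoGroup_def h_negneg_boolean_aut)
next
  fix f g assume "f \<in> carrier (heyting_AutoGroup L)" "g \<in> carrier (heyting_AutoGroup L)"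
  then have fg: "f \<in> heyting_aut L" "g \<in> heyting_aut L"
    by (simp_all add: heyting_AutoGroup_def)
  let ?B = "carrier (regular_algebra L)"
  have Bij: "f \<in> Bij (carrier L)" "g \<in> Bij (carrier L)" "h_negneg L f \<in> Bij ?B" "h_negneg L g \<in> Bij ?B"
    using fg h_negneg_boolean_aut by (auto simp: heyting_aut_def boolean_aut_def)
  have "g b \<in> ?B" if "b \<in> ?B" for b
    using regular_image [OF fg(2)] that by blast
  moreover have "?B \<subseteq> carrier L"
    by (auto simp: regular_algebra_simps)
  ultimately have "h_negneg L (compose (carrier L) f g) = compose ?B (h_negneg L f) (h_negneg L g)"
    by (auto simp: h_negneg_def compose_def fun_eq_iff restrict_def)
  then show "h_negneg L (f \<otimes>\<^bsub>heyting_AutoGroup L\<^esub> g) =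
      h_negneg L f \<otimes>\<^bsub>boolean_AutoGroup (regular_algebra L)\<^esub> h_negneg L g"
    using Bij by (simp add: heyting_AutoGroup_def boolean_AutoGroup_def BijGroup_def)
qed

text \<open>Finitely many regular elements are finitely many elements of \<open>L\<close>, so the
  same finite set controls both sides.\<close>

lemma h_negneg_continuous:
  "continuous_map (heyting_aut_topology L) (boolean_aut_topology (regular_algebra L)) (h_negneg L)"
  unfolding continuous_map_def
proof (intro conjI allI impI)
  show "h_negneg L \<in> topspace (heyting_aut_topology L) \<rightarrow> topspace (boolean_aut_topology (regular_algebra L))"
    using h_negneg_boolean_aut by simp
  fix U assume U: "openin (boolean_aut_topology (regular_algebra L)) U"
  have "\<exists>F. finite F \<and> F \<subseteq> carrier L \<and>
      (\<forall>g\<in>heyting_aut L. (\<forall>x\<in>F. g x = f x) \<longrightarrow> h_negneg L g \<in> U)"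
    if f: "h_negneg L f \<in> U" for f
  proof -
    obtain F where F: "finite F" "F \<subseteq> carrier (regular_algebra L)"
      "\<forall>g\<in>boolean_aut (regular_algebra L). (\<forall>x\<in>F. g x = h_negneg L f x) \<longrightarrow> g \<in> U"
      using U f unfolding openin_boolean_aut_topology by blast
    have "h_negneg L g \<in> U" if g: "g \<in> heyting_aut L" "\<forall>x\<in>F. g x = f x" for g
    proof -
      have "\<forall>x\<in>F. h_negneg L g x = h_negneg L f x"
        using F(2) g(2) by (auto simp: h_negneg_def)
      then show ?thesis using F(3) h_negneg_boolean_aut [OF g(1)] by blast
    qed
    moreover have "F \<subseteq> carrier L"
      using F(2) by (auto simp: regular_algebra_simps)
    ultimately show ?thesis using F(1) by blast
  qed
  then show "openin (heyting_aut_topology L) {f \<in> topspace (heyting_aut_topology L). h_negneg L f \<in> U}"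
    unfolding openin_heyting_aut_topology by auto
qed

text \<open>The points where two automorphisms agree form a set closed under the operations.\<close>

lemma heyting_aut_eq_on_hull:
  assumes f: "f \<in> heyting_aut L" and g: "g \<in> heyting_aut L"
    and R: "R \<subseteq> carrier L" "\<And>x. x \<in> R \<Longrightarrow> f x = g x" and a: "a \<in> heyting_closed L hull R"
  shows "f a = g a"
proof -
  note D = heyting_embD [OF heyting_aut_emb [OF f]] heyting_embD [OF heyting_aut_emb [OF g]]
  have "heyting_closed L {x \<in> carrier L. f x = g x}"
    by (auto simp: heyting_closed_def D)
  then have "heyting_closed L hull R \<subseteq> {x \<in> carrier L. f x = g x}"
    using R by (intro hull_minimal) auto
  then show ?thesis using a by blast
qed

lemma id_heyting_aut: "(\<lambda>x\<in>carrier L. x) \<in> heyting_aut L"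
  by (simp add: heyting_aut_def heyting_iso_iff heyting_emb_def Bij_def bij_betw_def inj_on_def)

lemma heyting_aut_complemented:
  assumes f: "f \<in> heyting_aut L" and x: "x \<in> carrier L" "x \<^bold>\<or> \<^bold>\<not> x = ltop L"
  shows "f x \<^bold>\<or> \<^bold>\<not> (f x) = ltop L"
proof -
  note fD = heyting_embD [OF heyting_aut_emb [OF f]]
  have "f x \<^bold>\<or> \<^bold>\<not> (f x) = f (x \<^bold>\<or> \<^bold>\<not> x)"
    using x(1) by (simp add: fD(6) heyting_aut_hneg [OF f])
  then show ?thesis using x(2) fD(3) by simp
qed

end

text \<open>The finite set \<open>R\<close> depends on \<open>a\<close> alone and works for all
  pairs of automorphisms. This uniformity gives openness onto the image in addition to
  injectivity.\<close>

lemma fraisse_heyting_aut_eq: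
  assumes L: "heyting_fraisse_limit L" and a: "a \<in> carrier L"
  shows "\<exists>R. finite R \<and> R \<subseteq> carrier (regular_algebra L) \<and>
    (\<forall>f\<in>heyting_aut L. \<forall>g\<in>heyting_aut L. (\<forall>x\<in>R. h_negneg L f x = h_negneg L g x) \<longrightarrow> f a = g a)"
proof -
  interpret heyting_algebra L
    using L by (simp add: heyting_fraisse_limit_def)
  obtain R where R: "finite R" "R \<subseteq> carrier (regular_algebra L)" "a \<in> heyting_closed L hull R"
    using fraisse_regular_hull [OF L a] by blast
  have "f a = g a" if fg: "f \<in> heyting_aut L" "g \<in> heyting_aut L"
    and "\<forall>x\<in>R. h_negneg L f x = h_negneg L g x" for f g
  proof (rule heyting_aut_eq_on_hull [OF fg _ _ R(3)])
    show "R \<subseteq> carrier L" using R(2) by (auto simp: regular_algebra_simps)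
    show "f x = g x" if "x \<in> R" for x
    proof -
      have "x \<in> carrier (regular_algebra L)" using that R(2) by blast
      then show ?thesis
        using that \<open>\<forall>x\<in>R. h_negneg L f x = h_negneg L g x\<close> by (auto simp: h_negneg_def)
    qed
  qed
  then show ?thesis using R(1,2) by blast
qed

lemma fraisse_h_negneg_inj:
  assumes L: "heyting_fraisse_limit L"
  shows "inj_on (h_negneg L) (heyting_aut L)"
proof (rule inj_onI)
  fix f g assume fg: "f \<in> heyting_aut L" "g \<in> heyting_aut L" and eq: "h_negneg L f = h_negneg L g"
  have "f a = g a" if "a \<in> carrier L" for a
    using fraisse_heyting_aut_eq [OF L that] fg eq by metis
  \<comment> \<open>Off the carrier both maps are \<open>undefined\<close>, so agreement on the
    carrier is equality of functions.\<close>
  moreover have "f \<in> extensional (carrier L)" "g \<in> extensional (carrier L)"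
    using fg by (auto simp: heyting_aut_def Bij_def)
  ultimately show "f = g" by (blast intro: extensionalityI)
qed

text \<open>A neighbourhood of \<open>f\<close> is controlled by a finite set \<open>F\<close>. Each
  point of \<open>F\<close> has a finite regular support, and the finite union of these supports
  controls a neighbourhood of the restriction of \<open>f\<close> within the image.\<close>

lemma fraisse_h_negneg_open_map:
  assumes L: "heyting_fraisse_limit L"
  shows "open_map (heyting_aut_topology L)
    (subtopology (boolean_aut_topology (regular_algebra L)) (h_negneg L ` heyting_aut L)) (h_negneg L)"
proof -
  interpret heyting_algebra L
    using L by (simp add: heyting_fraisse_limit_def)
  let ?h = "h_negneg L" and ?B = "carrier (regular_algebra L)" and ?G = "heyting_aut L"
  have im: "?h ` ?G \<subseteq> boolean_aut (regular_algebra L)"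
    using h_negneg_boolean_aut by blast
  have PiE: "?h ` ?G \<subseteq> ?B \<rightarrow>\<^sub>E ?B"
    using im by (intro Bij_PiE) (auto simp: boolean_aut_def)
  have "openin (pointwise_topology ?B (?h ` ?G)) (?h ` U)" if U: "openin (heyting_aut_topology L) U" for U
    unfolding openin_pointwise_topology [OF PiE]
  proof (intro conjI ballI)
    show "?h ` U \<subseteq> ?h ` ?G"
      using U unfolding openin_heyting_aut_topology by blast
    fix k assume "k \<in> ?h ` U"
    then obtain f where f: "f \<in> U" "k = ?h f" by blast
    obtain F where F: "finite F" "F \<subseteq> carrier L" "\<forall>g\<in>?G. (\<forall>x\<in>F. g x = f x) \<longrightarrow> g \<in> U" and fG: "f \<in> ?G"
      using U f(1) unfolding openin_heyting_aut_topology by blast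
    have "\<forall>a\<in>F. \<exists>R. finite R \<and> R \<subseteq> ?B \<and>
        (\<forall>f\<in>?G. \<forall>g\<in>?G. (\<forall>x\<in>R. ?h f x = ?h g x) \<longrightarrow> f a = g a)"
      using fraisse_heyting_aut_eq [OF L] F(2) by blast
    from bchoice [OF this] obtain R where
      R: "\<forall>a\<in>F. finite (R a) \<and> R a \<subseteq> ?B \<and> (\<forall>f\<in>?G. \<forall>g\<in>?G. (\<forall>x\<in>R a. ?h f x = ?h g x) \<longrightarrow> f a = g a)" ..
    have "?h g \<in> ?h ` U" if g: "g \<in> ?G" "\<forall>x\<in>(\<Union>a\<in>F. R a). ?h g x = ?h f x" for g
    proof -
      have "g a = f a" if "a \<in> F" for a
      proof -
        have "\<forall>x\<in>R a. ?h g x = ?h f x" using g(2) that by blast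
        then show ?thesis using R that g(1) fG by blast
      qed
      then show ?thesis using F(3) g(1) by blast
    qed
    then show "\<exists>F. finite F \<and> F \<subseteq> ?B \<and> (\<forall>g\<in>?h ` ?G. (\<forall>x\<in>F. g x = k x) \<longrightarrow> g \<in> ?h ` U)"
      using F(1) R f(2) by (intro exI [of _ "\<Union>a\<in>F. R a"]) blast
  qed
  then show ?thesis
    unfolding open_map_def subtopology_pointwise_topology [OF im] by blast
qed

text \<open>The complemented \<open>x\<close> is twisted to an element that is not complemented,
  which automorphisms of \<open>L\<close> cannot do. That the obstruction sits at a single point
  \<open>x\<close> serves non-density; the freedom in \<open>F\<close> serves non-openness.\<close>

lemma fraisse_twist:
  assumes L: "heyting_fraisse_limit L" and F: "finite F" "F \<subseteq> carrier (regular_algebra L)"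
  shows "\<exists>\<sigma>\<in>boolean_aut (regular_algebra L). \<exists>x\<in>carrier (regular_algebra L).
    (\<forall>a\<in>F. \<sigma> a = a) \<and> (\<forall>f\<in>heyting_aut L. h_negneg L f x \<noteq> \<sigma> x)"
proof -
  interpret heyting_algebra L
    using L by (simp add: heyting_fraisse_limit_def)
  have FL: "F \<subseteq> carrier L"
    using F(2) by (auto simp: regular_algebra_simps)
  obtain f d x where f: "f \<in> heyting_aut L" and d: "d \<in> carrier (regular_algebra L)"
    and x: "x \<in> carrier L" "x \<^bold>\<or> \<^bold>\<not> x = ltop L"
    and fix_F: "\<forall>a\<in>F. f a = a" and fix_d: "f d = d"
    and ne: "glue L d (f x) x \<^bold>\<or> \<^bold>\<not> (glue L d (f x) x) \<noteq> ltop L"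
    using fraisse_swap [OF L F(1) FL] by blast
  let ?\<sigma> = "\<lambda>u\<in>carrier (regular_algebra L). glue L d (f u) u"
  have xB: "x \<in> carrier (regular_algebra L)"
    using complemented_imp_regular x by (simp add: regular_algebra_simps)
  have "?\<sigma> a = a" if a: "a \<in> F" for a
  proof -
    have aB: "a \<in> carrier (regular_algebra L)" using a F(2) by blast
    then have "glue L d a a = a"
      using d by (intro glue_unique) (simp_all add: regular_algebra_simps)
    then show ?thesis using aB fix_F a by simp
  qed
  moreover have "h_negneg L g x \<noteq> ?\<sigma> x" if "g \<in> heyting_aut L" for g
    using heyting_aut_complemented [OF that x] ne xB by (auto simp: h_negneg_def)
  ultimately show ?thesis
    using twist_boolean_aut [OF f d fix_d] xB by blast
qed

theorem proposition2p6:
  fixes L :: "'a heyting" and B :: "'a boolean"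
  assumes "heyting_fraisse_limit L"
    and "B = regular_algebra L"
  shows "h_negneg L \<in> hom (heyting_AutoGroup L) (boolean_AutoGroup B)
    \<and> continuous_map (heyting_aut_topology L) (boolean_aut_topology B) (h_negneg L)
    \<and> inj_on (h_negneg L) (heyting_aut L)
    \<and> homeomorphic_map (heyting_aut_topology L)
           (subtopology (boolean_aut_topology B) (h_negneg L ` heyting_aut L)) (h_negneg L)
    \<and> h_negneg L ` heyting_aut L \<noteq> boolean_aut B
    \<and> boolean_aut_topology B closure_of (h_negneg L ` heyting_aut L) \<noteq> boolean_aut B
    \<and> \<not> openin (boolean_aut_topology B) (h_negneg L ` heyting_aut L)"
proof -
  note L = assms(1)
  interpret heyting_algebra L
    using L by (simp add: heyting_fraisse_limit_def)
  let ?h = "h_negneg L" and ?G = "heyting_aut L"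
  have inj: "inj_on ?h ?G"
    by (rule fraisse_h_negneg_inj [OF L])
  have im: "?h ` ?G \<subseteq> boolean_aut B"
    using h_negneg_boolean_aut assms(2) by blast
  have cont: "continuous_map (heyting_aut_topology L) (boolean_aut_topology B) ?h"
    using h_negneg_continuous assms(2) by simp
  have homeo: "homeomorphic_map (heyting_aut_topology L) (subtopology (boolean_aut_topology B) (?h ` ?G)) ?h"
  proof (rule bijective_open_imp_homeomorphic_map)
    show "continuous_map (heyting_aut_topology L) (subtopology (boolean_aut_topology B) (?h ` ?G)) ?h"
      using cont by (simp add: continuous_map_in_subtopology)
    show "open_map (heyting_aut_topology L) (subtopology (boolean_aut_topology B) (?h ` ?G)) ?h"
      using fraisse_h_negneg_open_map [OF L] assms(2) by simp
  qed (use im inj in \<open>auto simp: topspace_subtopology\<close>)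
  have dense: "boolean_aut_topology B closure_of (?h ` ?G) \<noteq> boolean_aut B"
  proof -
    obtain \<sigma> x where \<sigma>: "\<sigma> \<in> boolean_aut B" and x: "x \<in> carrier B" and ne: "\<forall>f\<in>?G. ?h f x \<noteq> \<sigma> x"
      using fraisse_twist [OF L, of "{}"] assms(2) by blast
    \<comment> \<open>Prescribing one value gives an open neighbourhood of \<open>\<sigma>\<close>,
      and no restricted automorphism takes this value at \<open>x\<close>.\<close>
    let ?T = "{g \<in> boolean_aut B. g x = \<sigma> x}"
    have "openin (boolean_aut_topology B) ?T"
      unfolding openin_boolean_aut_topology using x by (auto intro!: exI [of _ "{x}"])
    moreover have "\<sigma> \<in> ?T" "?T \<inter> ?h ` ?G = {}"
      using \<sigma> ne by auto
    ultimately have "\<sigma> \<notin> boolean_aut_topology B closure_of (?h ` ?G)"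
      using openin_Int_closure_of_eq_empty by blast
    then show ?thesis using \<sigma> by metis
  qed
  \<comment> \<open>A surjective map would have the whole space as the closure of its image.\<close>
  then have surj: "?h ` ?G \<noteq> boolean_aut B"
    using closure_of_topspace [of "boolean_aut_topology B"] by auto
  have "\<not> openin (boolean_aut_topology B) (?h ` ?G)"
  proof
    assume "openin (boolean_aut_topology B) (?h ` ?G)"
    \<comment> \<open>Openness is tested at the identity: the image would contain the pointwise
      stabilizer of a finite \<open>F\<close>, and a twist fixing \<open>F\<close> lies in that
      stabilizer but outside the image.\<close>
    then obtain F where F: "finite F" "F \<subseteq> carrier B"
      "\<forall>g\<in>boolean_aut B. (\<forall>x\<in>F. g x = ?h (\<lambda>x\<in>carrier L. x) x) \<longrightarrow> g \<in> ?h ` ?G"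
      unfolding openin_boolean_aut_topology using id_heyting_aut by blast
    obtain \<sigma> x where \<sigma>: "\<sigma> \<in> boolean_aut B" and fix_F: "\<forall>a\<in>F. \<sigma> a = a"
      and ne: "\<forall>f\<in>?G. ?h f x \<noteq> \<sigma> x"
      using fraisse_twist [OF L F(1)] F(2) assms(2) by blast
    have "?h (\<lambda>x\<in>carrier L. x) a = a" if "a \<in> F" for a
    proof -
      have "a \<in> carrier B" using that F(2) by blast
      then show ?thesis using assms(2) by (simp add: h_negneg_def regular_algebra_simps)
    qed
    then have "\<sigma> \<in> ?h ` ?G"
      using F(3) \<sigma> fix_F by simp
    then show False using ne by blast
  qed
  then show ?thesis
    using h_negneg_hom assms(2) cont inj homeo surj dense by simp
qed

end
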